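(* (1) For every $\beta\in(0,1)$ and every $c>0$, $\dim_H E(\beta,c)=1$. (2) For every $c\in(0,1]$, $\dim_H F(c)=\tfrac12$.
   Context: For irrational $\omega\in(0,1)$ let $a_1(\omega),a_2(\omega),\dots$ be its continued fraction partial quotients, $\omega=\cfrac{1}{a_1+\cfrac{1}{a_2+\cdots}}$, and let $R_n(\omega)$ be the number of distinct values among $a_1(\omega),\dots,a_n(\omega)$. For $\beta\ge0$, $c>0$ define $E(\beta,c)=\{\omega\in[0,1)\text{ irrational}: \lim_{n\to\infty}R_n(\omega)/n^\beta=c\}$ and $F(c)=E(1,c)=\{\omega: \lim_{n\to\infty}R_n(\omega)/n=c\}$. $\dim_H$ denotes Hausdorff dimension. *)

theory Defs
  imports "HOL-Analysis.Analysis"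
begin

definition hausdorff_pre :: "real \<Rightarrow> real \<Rightarrow> real set \<Rightarrow> ennreal" where
  "hausdorff_pre s \<delta> A =
     (INF U \<in> {U :: nat \<Rightarrow> real set. A \<subseteq> (\<Union>i. U i) \<and> (\<forall>i. bounded (U i) \<and> diameter (U i) \<le> \<delta>)}.
        (\<Sum>i. ennreal (diameter (U i) powr s)))"

definition hausdorff_measure :: "real \<Rightarrow> real set \<Rightarrow> ennreal" where
  "hausdorff_measure s A = (SUP \<delta> \<in> {0<..}. hausdorff_pre s \<delta> A)"

text \<open>Hausdorff dimension: infimum of the exponents s > 0 with zero s-dimensional
  Hausdorff measure (restricting to s > 0 avoids the 0^0 convention and gives the
  usual value since the Hausdorff measure is antitone in s).\<close>
definition hausdorff_dim :: "real set \<Rightarrow> real" where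
  "hausdorff_dim A = Inf {s. s > 0 \<and> hausdorff_measure s A = 0}"

definition gauss_map :: "real \<Rightarrow> real" where
  "gauss_map x = frac (1 / x)"

definition cf_digit :: "real \<Rightarrow> nat \<Rightarrow> nat" where
  "cf_digit \<omega> n = nat \<lfloor>1 / ((gauss_map ^^ (n - 1)) \<omega>)\<rfloor>"

definition R_count :: "nat \<Rightarrow> real \<Rightarrow> nat" where
  "R_count n \<omega> = card (cf_digit \<omega> ` {1..n})"

definition E_set :: "real \<Rightarrow> real \<Rightarrow> real set" where
  "E_set \<beta> c = {\<omega> \<in> {0..<1}. \<omega> \<notin> \<rat> \<and>
       (\<lambda>n. real (R_count n \<omega>) / real n powr \<beta>) \<longlonglongrightarrow> c}"

definition F_set :: "real \<Rightarrow> real set" where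
  "F_set c = E_set 1 c"

end

theory Submission
  imports Defs "HOL-Real_Asymp.Real_Asymp"
begin

text \<open>
  \<^emph>\<open>Upper bounds.\<close> For \<open>s > 1\<close> the unit interval is already a null set. If \<open>R\<^sub>n \<ge> c n\<close> eventually, then
  the digits of the \<open>n\<close>-th cylinder have product at least \<open>\<lceil>c n\<rceil>!\<close>, because distinct positive integers
  do, while the cylinder is no longer than the inverse square of that product. For \<open>1/2 < t < s\<close> the
  sum of \<open>(a\<^sub>1 \<cdots> a\<^sub>n)\<^bsup>-2s\<^esup>\<close> over these words is therefore at most \<open>\<zeta>(2t)\<^sup>n / (\<lceil>c n\<rceil>!)\<^bsup>2(s - t)\<^esup>\<close>.

  \<^emph>\<open>Lower bounds.\<close> Restrict the \<open>n\<close>-th digit to a finite set \<open>D n\<close> and give the cylinder of a word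
  mass by splitting the mass of its parent in proportion to length to the power \<open>s\<close>. If the normalising
  factors multiply up faster than the relative gaps between sibling cylinders shrink, any set of diameter
  \<open>d\<close> captures mass \<open>O(d\<^sup>s)\<close>, so the \<open>s\<close>-dimensional measure does not vanish. Let \<open>h\<close> grow in steps
  of 0 or 1 with \<open>h n \<sim> c n\<^sup>\<beta>\<close>, and put a new digit exactly at the jumps of \<open>h\<close>. For \<open>\<beta> < 1\<close> the new digits
  are prescribed, and the others range over \<open>{1..M}\<close>: every child has at most half the length of its
  parent, so the factor there is about \<open>2\<^bsup>1 - s\<^esup> > 1\<close>, which outweighs the few polynomial losses at
  the jumps. For \<open>\<beta> = 1\<close> the new digits range over dyadic blocks and all the others equal 1.
\<close>

subsection \<open>Hausdorff measure and dimension\<close>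

text \<open>The mesh bound in \<open>hausdorff_pre\<close> comes for free: if the whole sum is at
  most \<open>\<delta> powr s\<close>, so is each term, and each diameter is then at most
  \<open>\<delta>\<close>.\<close>

lemma hausdorff_measure_eq_0I:
  assumes s: "s > 0"
    and cov: "\<And>\<epsilon>. \<epsilon> > 0 \<Longrightarrow> \<exists>U :: nat \<Rightarrow> real set. A \<subseteq> (\<Union>i. U i) \<and> (\<forall>i. bounded (U i)) \<and>
                (\<Sum>i. ennreal (diameter (U i) powr s)) \<le> ennreal \<epsilon>"
  shows "hausdorff_measure s A = 0"
proof -
  have "hausdorff_pre s \<delta> A \<le> ennreal \<epsilon>" if "\<delta> > 0" "\<epsilon> > 0" for \<delta> \<epsilon>
  proof -
    define e where "e = min \<epsilon> (\<delta> powr s)"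
    have "e > 0" using that by (simp add: e_def)
    obtain U :: "nat \<Rightarrow> real set" where U: "A \<subseteq> (\<Union>i. U i)" "\<forall>i. bounded (U i)"
        "(\<Sum>i. ennreal (diameter (U i) powr s)) \<le> ennreal e"
      using cov[OF \<open>e > 0\<close>] by blast
    have "diameter (U i) \<le> \<delta>" for i
    proof -
      have "ennreal (diameter (U i) powr s) = (\<Sum>j\<in>{i}. ennreal (diameter (U j) powr s))"
        by simp
      also have "\<dots> \<le> (\<Sum>j. ennreal (diameter (U j) powr s))"
        by (intro sum_le_suminf) auto
      also have "\<dots> \<le> ennreal (\<delta> powr s)"
        using U(3) by (rule order_trans) (simp add: e_def ennreal_leI)
      finally have "diameter (U i) powr s \<le> \<delta> powr s"
        by simp
      then show ?thesis
        using powr_less_mono2[of s \<delta> "diameter (U i)"] s that by linarith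
    qed
    then have "hausdorff_pre s \<delta> A \<le> (\<Sum>i. ennreal (diameter (U i) powr s))"
      unfolding hausdorff_pre_def using U by (intro INF_lower) auto
    also have "\<dots> \<le> ennreal \<epsilon>"
      using U(3) by (rule order_trans) (simp add: e_def ennreal_leI)
    finally show ?thesis .
  qed
  note le = this
  have "hausdorff_pre s \<delta> A \<le> 0" if "\<delta> > 0" for \<delta>
    by (rule ennreal_le_epsilon, unfold add_0_left, rule le[OF that])
  then have "hausdorff_measure s A \<le> 0"
    unfolding hausdorff_measure_def by (intro SUP_least) auto
  then show ?thesis by simp
qed

lemma hausdorff_measure_0_cover:
  assumes "hausdorff_measure s A = 0" "\<epsilon> > 0"
  obtains U :: "nat \<Rightarrow> real set" where "A \<subseteq> (\<Union>i. U i)" "\<And>i. bounded (U i)"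
    "(\<Sum>i. ennreal (diameter (U i) powr s)) < ennreal \<epsilon>"
proof -
  have "hausdorff_pre s 1 A \<le> hausdorff_measure s A"
    unfolding hausdorff_measure_def by (intro SUP_upper) auto
  then have "hausdorff_pre s 1 A < ennreal \<epsilon>"
    using assms by simp
  then show ?thesis
    unfolding hausdorff_pre_def INF_less_iff using that by auto
qed

text \<open>Reduces arbitrary covers to covers by open balls, for which a compactness argument can
  supply the finite set \<open>I\<close>. The sets of a cheap cover are enlarged to balls at a total
  extra cost as small as desired.\<close>

lemma hausdorff_measure_nonzeroI:
  assumes s: "s > 0" and C: "C > 0"
    and cov: "\<And>(x :: nat \<Rightarrow> real) r. (\<And>i. r i > 0) \<Longrightarrow> A \<subseteq> (\<Union>i. ball (x i) (r i)) \<Longrightarrow>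
                \<exists>I. finite I \<and> 1 \<le> C * (\<Sum>i\<in>I. r i powr s)"
  shows "hausdorff_measure s A \<noteq> 0"
proof
  assume "hausdorff_measure s A = 0"
  \<comment> \<open>The diameters and the enlargements cost at most \<open>e\<close> each, so
    \<open>C\<close> times the total stays below 1/2.\<close>
  define e where "e = 1 / (4 * C)"
  have e: "e > 0" using C by (simp add: e_def)
  obtain U :: "nat \<Rightarrow> real set" where U: "A \<subseteq> (\<Union>i. U i)" "\<And>i. bounded (U i)"
    "(\<Sum>i. ennreal (diameter (U i) powr s)) < ennreal e"
    using hausdorff_measure_0_cover[OF \<open>hausdorff_measure s A = 0\<close> e] by blast
  define x where "x i = (SOME y. y \<in> U i)" for i
  \<comment> \<open>The added terms sum to \<open>e\<close> and make the radius exceed the diameter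
    strictly, even for sets of diameter 0.\<close>
  define r where "r i = (diameter (U i) powr s + e * (1/2) ^ Suc i) powr (1 / s)" for i
  have r_powr: "r i powr s = diameter (U i) powr s + e * (1/2) ^ Suc i" for i
    using s e by (simp add: r_def powr_powr add_nonneg_pos)
  have dr: "diameter (U i) < r i" for i
  proof -
    have "diameter (U i) powr s < r i powr s"
      using e by (simp add: r_powr)
    then show ?thesis
      using powr_mono2[of s "r i" "diameter (U i)"] s by (force simp: r_def)
  qed
  have "r i > 0" for i
    using dr[of i] diameter_ge_0[OF U(2)[of i]] by linarith
  moreover have "A \<subseteq> (\<Union>i. ball (x i) (r i))"
  proof
    fix y assume "y \<in> A"
    then obtain i where i: "y \<in> U i" using U(1) by blast
    then have "x i \<in> U i" unfolding x_def by (rule someI)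
    then have "dist (x i) y \<le> diameter (U i)"
      using i U(2) diameter_bounded_bound by blast
    then have "y \<in> ball (x i) (r i)"
      using dr[of i] by simp
    then show "y \<in> (\<Union>i. ball (x i) (r i))" by blast
  qed
  ultimately obtain I where I: "finite I" "1 \<le> C * (\<Sum>i\<in>I. r i powr s)"
    using cov by blast
  have "ennreal (\<Sum>i\<in>I. diameter (U i) powr s) = (\<Sum>i\<in>I. ennreal (diameter (U i) powr s))"
    by (subst sum_ennreal) auto
  also have "\<dots> \<le> (\<Sum>i. ennreal (diameter (U i) powr s))"
    using I(1) by (intro sum_le_suminf) auto
  also have "\<dots> < ennreal e" by (rule U(3))
  finally have 1: "(\<Sum>i\<in>I. diameter (U i) powr s) < e"
    by (simp add: ennreal_less_iff sum_nonneg)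
  have "(\<lambda>i. e * (1/2::real) ^ Suc i) sums e"
    using sums_mult[OF power_half_series, of e] by simp
  then have 2: "(\<Sum>i\<in>I. e * (1/2::real) ^ Suc i) \<le> e"
    using sum_le_suminf[of "\<lambda>i. e * (1/2::real) ^ Suc i" I] I(1) e
    by (auto simp: sums_iff)
  have "(\<Sum>i\<in>I. r i powr s) < 2 * e"
    using 1 2 by (simp add: r_powr sum.distrib)
  then have "C * (\<Sum>i\<in>I. r i powr s) < C * (2 * e)"
    using C by simp
  also have "\<dots> < 1" using C by (simp add: e_def)
  finally show False using I(2) by simp
qed

lemma hausdorff_dim_eqI:
  assumes "d > 0" and z: "\<And>s. s > d \<Longrightarrow> hausdorff_measure s A = 0"
    and nz: "\<And>s. 0 < s \<Longrightarrow> s < d \<Longrightarrow> hausdorff_measure s A \<noteq> 0"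
  shows "hausdorff_dim A = d"
proof -
  let ?S = "{s. s > 0 \<and> hausdorff_measure s A = 0}"
  have lb: "d \<le> s" if "s \<in> ?S" for s
    using that nz[of s] by force
  have "Inf ?S \<le> s" if "s > d" for s
    using that z[OF that] lb \<open>d > 0\<close> by (intro cInf_lower bdd_belowI[of _ d]) auto
  then have "Inf ?S \<le> d" by (rule dense_ge)
  moreover have "d \<le> Inf ?S"
  proof (rule cInf_greatest)
    \<comment> \<open>The infimum of an empty set of reals is unspecified, so a member has to be
      exhibited.\<close>
    have "d + 1 \<in> ?S" using z[of "d + 1"] \<open>d > 0\<close> by simp
    then show "?S \<noteq> {}" by blast
  qed (rule lb)
  ultimately show ?thesis by (simp add: hausdorff_dim_def)
qed

text \<open>Covering by \<open>n\<close> intervals of length 1/n costs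
  \<open>n powr (1 - s)\<close>, which tends to 0.\<close>

lemma hausdorff_measure_unit_interval_eq_0:
  assumes s: "s > 1" and A: "A \<subseteq> {0..<1}"
  shows "hausdorff_measure s A = 0"
proof (rule hausdorff_measure_eq_0I)
  fix \<epsilon> :: real assume \<epsilon>: "\<epsilon> > 0"
  have "(\<lambda>n. real n powr (1 - s)) \<longlonglongrightarrow> 0"
    using s by real_asymp
  then have "eventually (\<lambda>n. real n powr (1 - s) < \<epsilon>) sequentially"
    using \<epsilon> by (rule order_tendstoD)
  then obtain n :: nat where n: "n > 0" "real n powr (1 - s) < \<epsilon>"
    using eventually_happens'[OF sequentially_bot eventually_conj[OF eventually_gt_at_top[of "0::nat"]]]
    by blast
  define U where "U i = (if i < n then {real i / n .. (real i + 1) / n} else {})" for i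
  have "A \<subseteq> (\<Union>i. U i)"
  proof
    fix x assume "x \<in> A"
    then have x: "0 \<le> x" "x < 1" using A by auto
    define i where "i = nat \<lfloor>x * n\<rfloor>"
    have i: "real i \<le> x * n" "x * n < real i + 1"
      using x by (auto simp: i_def)
    have "x * n < n" using x n by simp
    then have "i < n" using i by linarith
    moreover have "x \<in> U i"
      using i n \<open>i < n\<close> by (simp add: U_def field_simps)
    ultimately show "x \<in> (\<Union>i. U i)" by blast
  qed
  moreover have "bounded (U i)" for i by (simp add: U_def)
  moreover have "(\<Sum>i. ennreal (diameter (U i) powr s)) \<le> ennreal \<epsilon>"
  proof -
    have d: "diameter (U i) = (if i < n then 1 / n else 0)" for i
      using n by (auto simp: U_def field_simps)
    have "(\<Sum>i. ennreal (diameter (U i) powr s)) = (\<Sum>i<n. ennreal (diameter (U i) powr s))"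
      by (rule suminf_finite) (auto simp: d)
    also have "\<dots> = ennreal (n * (1 / n) powr s)"
      by (simp add: d ennreal_of_nat_eq_real_of_nat ennreal_mult)
    also have "n * (1 / n) powr s = real n powr (1 - s)"
      using n by (simp add: powr_diff powr_divide)
    finally show ?thesis using n by (simp add: ennreal_leI)
  qed
  ultimately show "\<exists>U :: nat \<Rightarrow> real set. A \<subseteq> (\<Union>i. U i) \<and> (\<forall>i. bounded (U i)) \<and>
                (\<Sum>i. ennreal (diameter (U i) powr s)) \<le> ennreal \<epsilon>"
    by blast
qed (use s in simp)

subsection \<open>Continued fraction cylinders\<close>

text \<open>Words list their digits in reverse order: \<open>k # v\<close> appends the digit \<open>k\<close> to the expansion \<open>v\<close>,
  \<open>cf_den v\<close> is the denominator of its convergent and \<open>cf_den' v\<close> that of the previous one.\<close>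

fun cf_map :: "nat list \<Rightarrow> real \<Rightarrow> real" where
  "cf_map [] x = x"
| "cf_map (k # v) x = cf_map v (1 / (real k + x))"

fun cf_den and cf_den' :: "nat list \<Rightarrow> real" where
  "cf_den [] = 1"
| "cf_den (k # v) = real k * cf_den v + cf_den' v"
| "cf_den' [] = 0"
| "cf_den' (k # v) = cf_den v"

text \<open>For positive digits this is the distance from \<open>cf_map v 0\<close> to
  \<open>cf_map v 1\<close>, as \<open>cf_map_diff\<close> shows.\<close>

definition cyl_len :: "nat list \<Rightarrow> real" where
  "cyl_len v = 1 / (cf_den v * (cf_den v + cf_den' v))"

section \<open>Lengths and distortion of cylinders\<close>

lemma cf_den_bounds:
  assumes "0 \<notin> set v"
  shows "1 \<le> cf_den v" "0 \<le> cf_den' v" "cf_den' v \<le> cf_den v"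
proof -
  have "1 \<le> cf_den v \<and> 0 \<le> cf_den' v \<and> cf_den' v \<le> cf_den v"
    using assms
  proof (induction v)
    case (Cons k v)
    then have q: "1 \<le> cf_den v" "0 \<le> cf_den' v" and k: "real k \<ge> 1" by auto
    have "cf_den v \<le> real k * cf_den v"
      using mult_right_mono[OF k, of "cf_den v"] q by simp
    then show ?case using q
      unfolding cf_den.simps cf_den'.simps by linarith
  qed simp
  then show "1 \<le> cf_den v" "0 \<le> cf_den' v" "cf_den' v \<le> cf_den v" by auto
qed

lemma cyl_len_pos:
  assumes "0 \<notin> set v"
  shows "cyl_len v > 0"
  using cf_den_bounds[OF assms] by (simp add: cyl_len_def)

text \<open>\<open>cf_map v\<close> is a Moebius map of determinant 1 or -1 with denominator
  \<open>cf_den v + cf_den' v * x\<close>.\<close>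

lemma cf_map_diff:
  assumes "0 \<notin> set v" "0 \<le> x" "0 \<le> y"
  shows "\<bar>cf_map v x - cf_map v y\<bar> =
    \<bar>x - y\<bar> / ((cf_den v + cf_den' v * x) * (cf_den v + cf_den' v * y))"
  using assms
proof (induction v arbitrary: x y)
  case (Cons k v)
  have k: "real k \<ge> 1" using Cons.prems by (cases k) auto
  have q: "1 \<le> cf_den v" "0 \<le> cf_den' v"
    using cf_den_bounds[of v] Cons.prems by auto
  let ?X = "1 / (real k + x)" and ?Y = "1 / (real k + y)"
  have pos: "real k + x > 0" "real k + y > 0" using k Cons.prems by auto
  have "?X - ?Y = (y - x) / ((real k + x) * (real k + y))"
    using pos by (simp add: field_simps)
  then have 1: "\<bar>?X - ?Y\<bar> = \<bar>x - y\<bar> / ((real k + x) * (real k + y))"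
    using pos by (simp add: abs_mult abs_minus_commute)
  \<comment> \<open>The denominators form a cocycle: those of \<open>v\<close> at the new argument
    and of \<open>k # v\<close> at \<open>t\<close> differ by the factor \<open>k + t\<close>, which
    cancels against fact \<open>1\<close>.\<close>
  have 2: "cf_den v + cf_den' v * (1 / (real k + t)) = (cf_den (k # v) + cf_den' (k # v) * t) / (real k + t)"
    if "real k + t > 0" for t
    using that by (simp add: field_simps)
  have 3: "cf_den (k # v) + cf_den' (k # v) * t > 0" if "t \<ge> 0" for t
    using that q k by (simp add: add_pos_nonneg)
  have "\<bar>cf_map (k # v) x - cf_map (k # v) y\<bar> =
     \<bar>?X - ?Y\<bar> / ((cf_den v + cf_den' v * ?X) * (cf_den v + cf_den' v * ?Y))"
    using Cons pos by simp
  also have "\<dots> = \<bar>x - y\<bar> / ((cf_den (k # v) + cf_den' (k # v) * x) * (cf_den (k # v) + cf_den' (k # v) * y))"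
    unfolding 1 2[OF pos(1)] 2[OF pos(2)]
    using pos 3[of x] 3[of y] Cons.prems by (simp del: cf_den.simps cf_den'.simps)
  finally show ?case .
qed simp

text \<open>Bounded distortion: each of the two denominators is at most \<open>2 * cf_den v\<close>
  on the unit interval, whence the constant 4.\<close>

lemma cf_map_diff_ge:
  assumes "0 \<notin> set v" "x \<in> {0..1}" "y \<in> {0..1}"
  shows "cyl_len v * \<bar>x - y\<bar> \<le> 4 * \<bar>cf_map v x - cf_map v y\<bar>"
proof -
  note q = cf_den_bounds[OF assms(1)]
  have *: "0 < cf_den v + cf_den' v * t \<and> cf_den v + cf_den' v * t \<le> 2 * cf_den v"
    if "t \<in> {0..1}" for t
    using that q mult_mono[of "cf_den' v" "cf_den v" t 1] by (auto intro: add_pos_nonneg)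
  have "(cf_den v + cf_den' v * x) * (cf_den v + cf_den' v * y) \<le> (2 * cf_den v) * (2 * cf_den v)"
    using *[OF assms(2)] *[OF assms(3)] q by (intro mult_mono) auto
  also have "\<dots> \<le> 4 * (cf_den v * (cf_den v + cf_den' v))"
    using q by simp
  finally have "1 / (4 * (cf_den v * (cf_den v + cf_den' v))) \<le> 1 / ((cf_den v + cf_den' v * x) * (cf_den v + cf_den' v * y))"
    using *[OF assms(2)] *[OF assms(3)] q by (intro divide_left_mono mult_pos_pos) auto
  then have "4 * \<bar>x - y\<bar> * (1 / (4 * (cf_den v * (cf_den v + cf_den' v)))) \<le> 
    4 * \<bar>x - y\<bar> * (1 / ((cf_den v + cf_den' v * x) * (cf_den v + cf_den' v * y)))"
    by (intro mult_left_mono) auto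
  then show ?thesis
    using assms unfolding cyl_len_def by (subst cf_map_diff) auto
qed

lemma cf_map_diff_le:
  assumes "0 \<notin> set v" "x \<in> {0..1}" "y \<in> {0..1}"
  shows "\<bar>cf_map v x - cf_map v y\<bar> \<le> 1 / (cf_den v)\<^sup>2"
proof -
  note q = cf_den_bounds[OF assms(1)]
  have *: "cf_den v \<le> cf_den v + cf_den' v * t" if "t \<in> {0..1}" for t
    using that q by auto
  have "cf_den v * cf_den v \<le> (cf_den v + cf_den' v * x) * (cf_den v + cf_den' v * y)"
    using *[OF assms(2)] *[OF assms(3)] q by (intro mult_mono) auto
  then show ?thesis
    using assms q by (auto simp: cf_map_diff power2_eq_square intro!: frac_le mult_pos_pos)
qed

text \<open>With \<open>a\<close> and \<open>b\<close> the two denominators of \<open>v\<close>,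
  those in the child's length are at most \<open>k * (a + b)\<close> and
  \<open>3 * k * a\<close>.\<close>

lemma cyl_len_Cons_ge:
  assumes "0 \<notin> set v" "k \<ge> 1"
  shows "cyl_len v / (3 * (real k)\<^sup>2) \<le> cyl_len (k # v)"
proof -
  note q = cf_den_bounds[OF assms(1)]
  define a b where "a = cf_den v" and "b = cf_den' v"
  have ab: "a \<ge> 1" "0 \<le> b" "b \<le> a" using q by (auto simp: a_def b_def)
  have k: "real k \<ge> 1" using assms by simp
  have 1: "real k * a + b \<le> real k * (a + b)"
    using k ab mult_right_mono[of 1 "real k" b] by (simp add: algebra_simps)
  have 2: "real k * a + b + a \<le> 3 * real k * a"
  proof -
    have "a \<le> real k * a" using mult_right_mono[OF k, of a] ab by simp
    then show ?thesis using ab unfolding mult.assoc by linarith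
  qed
  have "(real k * a + b) * (real k * a + b + a) \<le> (real k * (a + b)) * (3 * real k * a)"
    using 1 2 ab k by (intro mult_mono) auto
  also have "\<dots> = 3 * (real k)\<^sup>2 * (a * (a + b))"
    by (simp add: power2_eq_square)
  finally have "1 / (3 * (real k)\<^sup>2 * (a * (a + b))) \<le> 1 / ((real k * a + b) * (real k * a + b + a))"
    using ab k by (intro divide_left_mono mult_pos_pos) (auto intro: add_pos_nonneg add_nonneg_pos)
  then show ?thesis
    unfolding cyl_len_def cf_den.simps cf_den'.simps a_def[symmetric] b_def[symmetric]
    by (simp add: mult_ac)
qed

text \<open>The longest child is \<open>k = 1\<close>; already there the two factors are at least
  \<open>a + b\<close> and \<open>2 * a\<close>.\<close>

lemma cyl_len_Cons_le_half:
  assumes "0 \<notin> set v" "k \<ge> 1"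
  shows "cyl_len (k # v) \<le> cyl_len v / 2"
proof -
  note q = cf_den_bounds[OF assms(1)]
  define a b where "a = cf_den v" and "b = cf_den' v"
  have ab: "a \<ge> 1" "0 \<le> b" "b \<le> a" using q by (auto simp: a_def b_def)
  have ka: "a \<le> real k * a"
    using mult_right_mono[of 1 "real k" a] assms(2) ab by simp
  have "(a + b) * (2 * a) \<le> (real k * a + b) * (real k * a + b + a)"
  proof (intro mult_mono)
    show "a + b \<le> real k * a + b" "2 * a \<le> real k * a + b + a" "0 \<le> real k * a + b" "0 \<le> 2 * a"
      using ab ka by linarith+
  qed
  then have "1 / ((real k * a + b) * (real k * a + b + a)) \<le> 1 / ((a + b) * (2 * a))"
    using ab ka by (intro divide_left_mono mult_pos_pos; linarith)
  then show ?thesis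
    unfolding cyl_len_def cf_den.simps cf_den'.simps a_def[symmetric] b_def[symmetric]
    by (simp add: mult_ac)
qed

text \<open>Consecutive children share an endpoint, so their lengths telescope; the part left over
  by the first \<open>M\<close> children is a share of at most 2/(M + 2).\<close>

lemma sum_cyl_len_Cons:
  assumes "0 \<notin> set v"
  shows "(\<Sum>k=1..M. cyl_len (k # v)) \<ge> (1 - 2 / (real M + 2)) * cyl_len v"
proof -
  note q = cf_den_bounds[OF assms(1)]
  define a b where "a = cf_den v" and "b = cf_den' v"
  have ab: "a \<ge> 1" "0 \<le> b" "b \<le> a" using q by (auto simp: a_def b_def)
  have pos: "real k * a + b > 0" if "k \<ge> 1" for k
    using that ab by (simp add: add_pos_nonneg)
  have term_eq: "cyl_len (k # v) = (1 / (real k * a + b) - 1 / (real (Suc k) * a + b)) / a" if "k \<ge> 1" for k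
  proof -
    define X where "X = real k * a + b"
    have X: "X > 0" using pos[OF that] by (simp add: X_def)
    have "1 / X - 1 / (X + a) = a / (X * (X + a))"
      using X ab by (simp add: field_simps)
    then have "1 / (X * (X + a)) = (1 / X - 1 / (X + a)) / a"
      using ab by simp
    then show ?thesis
      unfolding cyl_len_def cf_den.simps cf_den'.simps a_def[symmetric] b_def[symmetric] X_def
      by (simp add: algebra_simps)
  qed
  have "(\<Sum>k=1..M. cyl_len (k # v)) = (1 / (a + b) - 1 / (real (Suc M) * a + b)) / a"
  proof (induction M)
    case (Suc M)
    then show ?case by (simp add: term_eq diff_divide_distrib)
  qed simp
  also have "\<dots> \<ge> (1 - 2 / (real M + 2)) * (1 / (a * (a + b)))"
  proof -
    have "real M * b \<le> real M * a" using ab by (intro mult_left_mono) auto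
    \<comment> \<open>The left side increases with \<open>b\<close>, and equality holds at the
      extreme case \<open>b = a\<close>.\<close>
    then have "(a + b) / (real (Suc M) * a + b) \<le> 2 / (real M + 2)"
      using pos[of "Suc M"] by (simp add: field_simps)
    then have "(1 - 2 / (real M + 2)) * (1 / (a * (a + b))) \<le> (1 - (a + b) / (real (Suc M) * a + b)) * (1 / (a * (a + b)))"
      using ab by (intro mult_right_mono) auto
    also have "\<dots> = (1 / (a + b) - 1 / (real (Suc M) * a + b)) / a"
      using pos[of "Suc M"] ab by (simp add: field_simps)
    finally show ?thesis .
  qed
  finally show ?thesis by (simp add: cyl_len_def a_def b_def)
qed

section \<open>Points with a prescribed digit sequence\<close>

primrec cf_prefix :: "(nat \<Rightarrow> nat) \<Rightarrow> nat \<Rightarrow> nat list" where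
  "cf_prefix a 0 = []"
| "cf_prefix a (Suc n) = a n # cf_prefix a n"

lemma length_cf_prefix [simp]: "length (cf_prefix a n) = n"
  by (induction n) auto

lemma cf_prefix_pos:
  assumes "\<And>n. a n \<ge> 1"
  shows "0 \<notin> set (cf_prefix a n)"
proof (induction n)
  case (Suc n)
  then show ?case using assms[of n] by auto
qed simp

lemma inverse_add_in_unit:
  assumes "k \<ge> 1" "x \<in> {0..1}"
  shows "1 / (real k + x) \<in> {0..1}"
proof -
  have "real k \<ge> 1" using assms by simp
  then show ?thesis using assms(2) by (auto simp: field_simps)
qed

lemma continuous_on_cf_map:
  assumes "0 \<notin> set v"
  shows "continuous_on {0..1} (cf_map v)"
  using assms
proof (induction v)
  case (Cons k v)
  then have k: "k \<ge> 1" by (cases k) auto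
  have "continuous_on {0..1} (\<lambda>x. 1 / (real k + x))"
    using k by (intro continuous_intros) auto
  moreover have "(\<lambda>x. 1 / (real k + x)) ` {0..1} \<subseteq> {0..1}"
    using inverse_add_in_unit[OF k] by blast
  ultimately show ?case
    using Cons continuous_on_compose2[of "{0..1}" "cf_map v" "{0..1}" "\<lambda>x. 1 / (real k + x)"] by simp
qed (simp add: continuous_on_id)

lemma cf_map_Cons_image:
  assumes "k \<ge> 1"
  shows "cf_map (k # v) ` {0..1} \<subseteq> cf_map v ` {0..1}"
  using inverse_add_in_unit[OF assms] by auto

lemma cf_map_inj:
  assumes "0 \<notin> set v" "x \<in> {0..1}" "y \<in> {0..1}" "cf_map v x = cf_map v y"
  shows "x = y"
proof -
  have "cyl_len v * \<bar>x - y\<bar> \<le> 0"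
    using cf_map_diff_ge[OF assms(1-3)] assms(4) by simp
  then show ?thesis
    using cyl_len_pos[OF assms(1)] by (simp add: mult_le_0_iff)
qed

lemma cyl_len_le_half_power:
  assumes "0 \<notin> set v"
  shows "cyl_len v \<le> (1 / 2) ^ length v"
  using assms
proof (induction v)
  case (Cons k v)
  then have "cyl_len (k # v) \<le> cyl_len v / 2"
    by (intro cyl_len_Cons_le_half) (auto simp: Suc_le_eq)
  then show ?case using Cons by simp
qed (simp add: cyl_len_def)

text \<open>Cylinders shrink uniformly in their depth, so those around a point eventually fit into
  any of its neighbourhoods. The factor 2 reflects \<open>cf_den' v \<le> cf_den v\<close>.\<close>

lemma cf_map_diff_le_half_power:
  assumes "0 \<notin> set v" "x \<in> {0..1}" "y \<in> {0..1}"
  shows "\<bar>cf_map v x - cf_map v y\<bar> \<le> 2 * (1 / 2) ^ length v"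
proof -
  note q = cf_den_bounds[OF assms(1)]
  have "cf_den v * (cf_den v + cf_den' v) \<le> cf_den v * (2 * cf_den v)"
    using q by (intro mult_left_mono) auto
  then have "1 / (cf_den v * (2 * cf_den v)) \<le> cyl_len v"
    using q unfolding cyl_len_def by (intro divide_left_mono mult_pos_pos) auto
  then have "1 / (cf_den v)\<^sup>2 \<le> 2 * cyl_len v"
    by (simp add: power2_eq_square)
  then show ?thesis
    using cf_map_diff_le[OF assms] cyl_len_le_half_power[OF assms(1)] by linarith
qed

text \<open>The Gauss map performs the Euclidean algorithm, sending p/q to (q mod p)/p. Hence an
  orbit that never meets 0 starts at an irrational point.\<close>

lemma gauss_map_of_nat_quotient:
  assumes "p < q"
  shows "\<exists>n. (gauss_map ^^ n) (real p / real q) = 0"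
  using assms
proof (induction q arbitrary: p rule: less_induct)
  case (less q)
  show ?case
  proof (cases "p = 0")
    case True
    then have "(gauss_map ^^ 0) (real p / real q) = 0" by simp
    then show ?thesis by blast
  next
    case False
    have "gauss_map (real p / real q) = real (q mod p) / real p"
    proof -
      have "real q = real (p * (q div p) + q mod p)" by simp
      then have "real q / real p = real (q div p) + real (q mod p) / real p"
        using False unfolding of_nat_add of_nat_mult by (simp add: field_simps)
      then show ?thesis
        using floor_divide_of_nat_eq[of q p, where ?'a = real]
        by (simp add: gauss_map_def frac_def)
    qed
    moreover obtain n where "(gauss_map ^^ n) (real (q mod p) / real p) = 0"
      using less.IH[of p "q mod p"] less.prems False by auto
    ultimately have "(gauss_map ^^ Suc n) (real p / real q) = 0"
      by (simp add: funpow_swap1)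
    then show ?thesis by blast
  qed
qed

lemma gauss_map_rational:
  assumes "x \<in> \<rat>" "0 \<le> x" "x < 1"
  shows "\<exists>n. (gauss_map ^^ n) x = 0"
proof -
  obtain p q :: nat where "q \<noteq> 0" "\<bar>x\<bar> = real p / real q"
    using Rats_abs_nat_div_natE[OF assms(1)] by metis
  moreover from this have "real p < real q" using assms by (simp add: divide_less_eq)
  then have "p < q" by simp
  ultimately show ?thesis
    using gauss_map_of_nat_quotient[of p q] assms by simp
qed

lemma gauss_map_irrational:
  assumes "x \<notin> \<rat>"
  shows "gauss_map x \<notin> \<rat>" "0 < gauss_map x" "gauss_map x < 1"
proof -
  show 1: "gauss_map x \<notin> \<rat>"
  proof
    assume "gauss_map x \<in> \<rat>"
    then have "1 / x - of_int \<lfloor>1 / x\<rfloor> + of_int \<lfloor>1 / x\<rfloor> \<in> \<rat>"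
      unfolding gauss_map_def frac_def by (intro Rats_add) auto
    then have "inverse (1 / x) \<in> \<rat>" by (intro Rats_inverse) simp
    then show False using assms by simp
  qed
  have "gauss_map x \<noteq> 0" using 1 by (metis Rats_0)
  then show "0 < gauss_map x" "gauss_map x < 1"
    using frac_ge_0[of "1 / x"] frac_lt_1[of "1 / x"] unfolding gauss_map_def by linarith+
qed

text \<open>The nested compact cylinders have a common point. Its parameters \<open>y n\<close> in
  them turn out to be its Gauss orbit, from which digits and irrationality are read off.\<close>

lemma cf_point_exists:
  assumes a: "\<And>n. a n \<ge> 1"
  obtains x where "\<And>n. x \<in> cf_map (cf_prefix a n) ` {0..1}" "0 < x" "x < 1" "x \<notin> \<rat>"
    "\<And>n. cf_digit x (Suc n) = a n"
proof -
  let ?F = "\<lambda>n. cf_map (cf_prefix a n) ` {0..1}"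
  note pos = cf_prefix_pos[of a, OF a]
  have "compact (?F n)" for n
    by (intro compact_continuous_image continuous_on_cf_map pos) auto
  moreover have "?F n \<noteq> {}" for n by simp
  moreover have "?F n \<subseteq> ?F m" if "m \<le> n" for m n
    using that
  proof (induction rule: dec_induct)
    case (step n)
    then show ?case using cf_map_Cons_image[OF a[of n], of "cf_prefix a n"] by simp
  qed simp
  ultimately have "\<Inter>(range ?F) \<noteq> {}" by (intro compact_nest) auto
  then obtain x where x: "\<And>n. x \<in> ?F n" by blast
  then have "\<forall>n. \<exists>y\<in>{0..1}. x = cf_map (cf_prefix a n) y" by blast
  then obtain y where y: "\<And>n. y n \<in> {0..1}" "\<And>n. x = cf_map (cf_prefix a n) (y n)"
    by metis
  \<comment> \<open>Both sides are parameters of the same point \<open>x\<close>, so injectivity of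
    \<open>cf_map\<close> yields the recurrence of the tails.\<close>
  have rec: "y n = 1 / (real (a n) + y (Suc n))" for n
  proof (rule cf_map_inj[OF pos[of n] y(1)])
    show "1 / (real (a n) + y (Suc n)) \<in> {0..1}"
      using inverse_add_in_unit[OF a y(1)] .
    show "cf_map (cf_prefix a n) (y n) = cf_map (cf_prefix a n) (1 / (real (a n) + y (Suc n)))"
      using y(2)[of n] y(2)[of "Suc n"] by simp
  qed
  have a': "real (a n) \<ge> 1" for n using a[of n] by simp
  \<comment> \<open>Endpoints are excluded: a tail is positive as a reciprocal, and less than 1
    because the next tail is positive. This makes the floor below unambiguous.\<close>
  have y_pos: "y n > 0" for n
    using rec[of n] y(1)[of "Suc n"] a'[of n] by simp
  have y_less: "y n < 1" for n
    using rec[of n] y_pos[of "Suc n"] a'[of n] by simp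
  have inv: "1 / y n = real (a n) + y (Suc n)" for n
    using rec[of n] by simp
  have floor: "\<lfloor>1 / y n\<rfloor> = int (a n)" for n
    using y_pos[of "Suc n"] y_less[of "Suc n"] unfolding inv by linarith
  have orbit: "(gauss_map ^^ n) x = y n" for n
  proof (induction n)
    case 0
    then show ?case using y(2)[of 0] by simp
  next
    case (Suc n)
    then show ?case using floor[of n] inv[of n] by (simp add: gauss_map_def frac_def)
  qed
  show ?thesis
  proof (rule that)
    show "x \<in> ?F n" for n by (rule x)
    show "0 < x" "x < 1" using y_pos[of 0] y_less[of 0] orbit[of 0] by auto
    then show "x \<notin> \<rat>" using gauss_map_rational[of x] orbit y_pos by (metis less_imp_le less_irrefl)
    show "cf_digit x (Suc n) = a n" for n
      by (simp add: cf_digit_def orbit floor)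
  qed
qed

subsection \<open>Mass distribution on a digit tree\<close>

locale digit_tree =
  fixes D :: "nat \<Rightarrow> nat set" and s :: real
  assumes finite_D: "finite (D n)" and D_nonempty: "D n \<noteq> {}" and D_pos: "0 \<notin> D n"
    and s_pos: "s > 0"
begin

section \<open>Words of the tree and their mass\<close>

fun allowed :: "nat list \<Rightarrow> bool" where
  "allowed [] = True"
| "allowed (k # v) = (k \<in> D (length v) \<and> allowed v)"

fun mass :: "nat list \<Rightarrow> real" where
  "mass [] = 1"
| "mass (k # v) = mass v * (cyl_len (k # v) powr s / (\<Sum>i\<in>D (length v). cyl_len (i # v) powr s))"

text \<open>Mass of those descendants \<open>r\<close> levels below \<open>v\<close> whose entire
  cylinder lies in \<open>V\<close>: a finite-level inner approximation to the measure of
  \<open>V\<close> inside the cylinder of \<open>v\<close>.\<close>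

fun captured :: "real set \<Rightarrow> nat \<Rightarrow> nat list \<Rightarrow> real" where
  "captured V 0 v = (if cf_map v ` {0..1} \<subseteq> V then mass v else 0)"
| "captured V (Suc r) v = (\<Sum>k\<in>D (length v). captured V r (k # v))"

lemma digit_ge_1: "k \<in> D n \<Longrightarrow> k \<ge> 1"
  using D_pos[of n] by (cases k) auto

lemma allowed_pos: "allowed v \<Longrightarrow> 0 \<notin> set v"
proof (induction v)
  case (Cons k v)
  then show ?case using digit_ge_1[of k "length v"] by auto
qed simp

lemma mass_nonneg: "mass v \<ge> 0"
  by (induction v) (auto intro!: mult_nonneg_nonneg divide_nonneg_nonneg sum_nonneg)

lemma sum_cyl_len_pos:
  assumes "allowed v"
  shows "(\<Sum>i\<in>D (length v). cyl_len (i # v) powr s) > 0"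
proof (rule sum_pos)
  show "0 < cyl_len (i # v) powr s" if "i \<in> D (length v)" for i
    using that assms cyl_len_pos[of "i # v"] allowed_pos[of "i # v"] by simp
qed (use finite_D D_nonempty in auto)

lemma sum_mass_children:
  assumes "allowed v"
  shows "(\<Sum>k\<in>D (length v). mass (k # v)) = mass v"
  using sum_cyl_len_pos[OF assms]
  by (simp add: sum_distrib_left[symmetric] sum_divide_distrib[symmetric])

lemma captured_nonneg: "captured V r v \<ge> 0"
  by (induction r arbitrary: v) (auto intro: sum_nonneg mass_nonneg)

lemma captured_le_mass:
  assumes "allowed v"
  shows "captured V r v \<le> mass v"
  using assms
proof (induction r arbitrary: v)
  case (Suc r)
  have "captured V (Suc r) v \<le> (\<Sum>k\<in>D (length v). mass (k # v))"
    unfolding captured.simps using Suc by (intro sum_mono Suc.IH) simp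
  then show ?case using sum_mass_children Suc.prems by simp
qed (simp add: mass_nonneg)

lemma captured_eq_mass:
  assumes "allowed v" "cf_map v ` {0..1} \<subseteq> V"
  shows "captured V r v = mass v"
  using assms
proof (induction r arbitrary: v)
  case (Suc r)
  have "captured V (Suc r) v = (\<Sum>k\<in>D (length v). mass (k # v))"
    unfolding captured.simps
  proof (intro sum.cong refl Suc.IH)
    fix k assume "k \<in> D (length v)"
    then show "allowed (k # v)" "cf_map (k # v) ` {0..1} \<subseteq> V"
      using Suc.prems cf_map_Cons_image[OF digit_ge_1, of k "length v" v] by auto
  qed
  then show ?case using sum_mass_children Suc.prems by simp
qed simp

text \<open>A captured descendant supplies a point of \<open>V\<close> whose parameter in
  \<open>v\<close> is 1 or begins with a digit at most \<open>B (length v)\<close>. It therefore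
  stays away from 0, where adjacent siblings could touch.\<close>

lemma captured_nonzero_point:
  assumes "allowed v" "captured V r v \<noteq> 0" and B: "\<And>n k. k \<in> D n \<Longrightarrow> real k \<le> B n"
  shows "\<exists>y\<in>{1 / (B (length v) + 1)..1}. cf_map v y \<in> V"
  using assms(1,2)
proof (induction r arbitrary: v)
  case 0
  have "B (length v) \<ge> 0"
    using D_nonempty[of "length v"] B[of _ "length v"] by (meson ex_in_conv of_nat_0_le_iff order_trans)
  moreover have "cf_map v 1 \<in> V" using 0 by (auto split: if_splits)
  ultimately show ?case by (intro bexI[of _ 1]) auto
next
  case (Suc r)
  then obtain k where k: "k \<in> D (length v)" "captured V r (k # v) \<noteq> 0"
    by (auto elim: sum.not_neutral_contains_not_neutral)
  have Bn: "B n \<ge> 0" for n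
    using D_nonempty[of n] B[of _ n] by (meson ex_in_conv of_nat_0_le_iff order_trans)
  obtain y where y: "y \<in> {1 / (B (length (k # v)) + 1)..1}" "cf_map (k # v) y \<in> V"
    using Suc.IH[of "k # v"] Suc.prems k by auto
  have "0 \<le> 1 / (B (length (k # v)) + 1)" using Bn[of "length (k # v)"] by simp
  then have "y \<in> {0..1}" using y(1) unfolding atLeastAtMost_iff by linarith
  moreover have "real k \<ge> 1" "real k \<le> B (length v)" using digit_ge_1 k(1) B by auto
  ultimately have "1 / (real k + y) \<in> {1 / (B (length v) + 1)..1}"
    using Bn[of "length v"] by (auto intro!: divide_left_mono)
  then show ?case using y(2) by auto
qed

text \<open>\<open>z\<close> bounds from below the factor by which one subdivision increases the sum
  of the \<open>s\<close>-th powers of the lengths. \<open>growth\<close> demands that these factors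
  accumulate faster than the relative gaps between siblings, raised to the power \<open>s\<close>,
  shrink.\<close>

context
  fixes B z :: "nat \<Rightarrow> real" and \<kappa> :: real
  assumes B: "\<And>n k. k \<in> D n \<Longrightarrow> real k \<le> B n"
    and z_pos: "\<And>n. z n > 0"
    and z: "\<And>v. allowed v \<Longrightarrow>
      z (length v) * cyl_len v powr s \<le> (\<Sum>k\<in>D (length v). cyl_len (k # v) powr s)"
    and \<kappa>: "\<kappa> > 0"
    and growth: "\<And>n. \<kappa> * ((B n + 1)\<^sup>2 * (B (Suc n) + 1)) powr s \<le> (\<Prod>i<n. z i)"
begin

lemma B_ge_1: "B n \<ge> 1"
proof -
  obtain k where "k \<in> D n" using D_nonempty by blast
  then show ?thesis using B[of k n] digit_ge_1[of k n] by simp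
qed

text \<open>The normalising sum of each level is at least \<open>z\<close> times the parent's length
  to the power \<open>s\<close>, so the lengths telescope along the word.\<close>

lemma mass_times_prod_le:
  assumes "allowed v"
  shows "mass v * (\<Prod>i<length v. z i) \<le> cyl_len v powr s"
  using assms
proof (induction v)
  case Nil
  then show ?case by (simp add: cyl_len_def)
next
  case (Cons k v)
  let ?L = "cyl_len (k # v) powr s" and ?S = "\<Sum>i\<in>D (length v). cyl_len (i # v) powr s"
  have S: "?S > 0" using sum_cyl_len_pos Cons.prems by simp
  have "mass (k # v) * (\<Prod>i<length (k # v). z i) =
      mass v * (\<Prod>i<length v. z i) * (z (length v) * (?L / ?S))"
    by simp
  also have "\<dots> \<le> cyl_len v powr s * (z (length v) * (?L / ?S))"
    using Cons z_pos[of "length v"] S by (intro mult_right_mono) auto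
  also have "\<dots> = z (length v) * cyl_len v powr s * (?L / ?S)" by simp
  also have "\<dots> \<le> ?S * (?L / ?S)"
    using z[of v] Cons.prems S by (intro mult_right_mono) auto
  also have "\<dots> = ?L" using S by simp
  finally show ?case .
qed

text \<open>Up to a constant, \<open>cyl_len v / gap (length v)\<close> is the least distance
  between relevant points of two children of \<open>v\<close>. The square comes from the reciprocals
  of the two digits, the other factor from the digit after them.\<close>

definition gap :: "nat \<Rightarrow> real" where
  "gap n = (B n + 1)\<^sup>2 * (B (Suc n) + 1)"

lemma gap_ge_1: "gap n \<ge> 1"
proof -
  have "1 * 1 \<le> (B n + 1)\<^sup>2 * (B (Suc n) + 1)"
    using B_ge_1[of n] B_ge_1[of "Suc n"] by (intro mult_mono one_le_power) auto
  then show ?thesis by (simp add: gap_def)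
qed

text \<open>Here \<open>growth\<close> is spent: the gain from \<open>mass_times_prod_le\<close>
  pays for \<open>d\<close> being smaller than the cylinder by a factor of order
  \<open>gap\<close>.\<close>

lemma mass_le:
  assumes v: "allowed v" and d: "cyl_len v / gap (length v) \<le> 4 * d"
  shows "mass v \<le> (4 * d) powr s / \<kappa>"
proof -
  let ?G = "gap (length v)"
  have G: "?G \<ge> 1" by (rule gap_ge_1)
  have l: "cyl_len v > 0" using cyl_len_pos allowed_pos v by blast
  have "mass v * (\<kappa> * ?G powr s) \<le> mass v * (\<Prod>i<length v. z i)"
    using growth[of "length v"] by (intro mult_left_mono) (auto simp: gap_def mass_nonneg)
  also have "\<dots> \<le> cyl_len v powr s" using v by (rule mass_times_prod_le)
  finally have "mass v * \<kappa> \<le> cyl_len v powr s / ?G powr s"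
    using G by (simp add: field_simps)
  also have "\<dots> = (cyl_len v / ?G) powr s"
    using l G by (simp add: powr_divide)
  also have "\<dots> \<le> (4 * d) powr s"
    using d l G s_pos by (intro powr_mono2) auto
  finally show ?thesis using \<kappa> by (simp add: field_simps)
qed

text \<open>For \<open>k = j + 1\<close> the siblings share the endpoint \<open>x = 1\<close>,
  \<open>y = 0\<close>; the lower bound on \<open>y\<close> keeps away from it. Distortion carries
  the gap between the reciprocals over to \<open>cf_map v\<close>.\<close>

lemma children_separated:
  assumes v: "allowed v" and jk: "j \<in> D (length v)" "k \<in> D (length v)" "j < k"
    and x: "x \<in> {0..1}" and y: "y \<in> {1 / (B (Suc (length v)) + 1)..1}"
  shows "cyl_len v / gap (length v) \<le> 4 * \<bar>cf_map (j # v) x - cf_map (k # v) y\<bar>"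
proof -
  let ?b = "B (length v)" and ?b' = "B (Suc (length v))"
  have j: "1 \<le> real j" "real j \<le> ?b" and k: "1 \<le> real k" "real k \<le> ?b" and jk1: "real j + 1 \<le> real k"
    using jk digit_ge_1 B by (auto simp: Suc_le_eq)
  have b': "0 < 1 / (?b' + 1)" using B_ge_1[of "Suc (length v)"] by simp
  have y01: "y \<in> {0..1}" using less_le_trans[OF b', of y] y by simp
  have "1 / gap (length v) = 1 / (?b' + 1) / ((?b + 1) * (?b + 1))"
    by (simp add: gap_def power2_eq_square)
  also have "\<dots> \<le> (real k + y - (real j + x)) / ((real j + x) * (real k + y))"
  proof (rule frac_le)
    \<comment> \<open>Since \<open>k\<close> is at least \<open>j + 1\<close> and \<open>x\<close>
      at most 1, the difference is at least \<open>y\<close>.\<close>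
    show "1 / (?b' + 1) \<le> real k + y - (real j + x)" using jk1 x y by simp
    then show "0 \<le> real k + y - (real j + x)" using b' by linarith
    show "0 < (real j + x) * (real k + y)" using j k x y01 by (intro mult_pos_pos) auto
    show "(real j + x) * (real k + y) \<le> (?b + 1) * (?b + 1)"
      using j k x y01 by (intro mult_mono) auto
  qed
  also have "\<dots> = 1 / (real j + x) - 1 / (real k + y)"
    using j k x y01 by (simp add: diff_frac_eq)
  also have "\<dots> \<le> \<bar>1 / (real j + x) - 1 / (real k + y)\<bar>" by simp
  finally have "cyl_len v * (1 / gap (length v)) \<le> cyl_len v * \<bar>1 / (real j + x) - 1 / (real k + y)\<bar>"
    using cyl_len_pos[OF allowed_pos[OF v]] by (intro mult_left_mono) auto
  also have "\<dots> \<le> 4 * \<bar>cf_map v (1 / (real j + x)) - cf_map v (1 / (real k + y))\<bar>"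
    using inverse_add_in_unit[of j x] inverse_add_in_unit[of k y] j k x y01
    by (intro cf_map_diff_ge allowed_pos v) auto
  finally show ?thesis by simp
qed

text \<open>Descend while only one child captures anything. Where two children do, \<open>V\<close>
  reaches across the gap between them, so \<open>d\<close> is large enough for
  \<open>mass_le\<close>; at the bottom, \<open>V\<close> contains a whole cylinder.\<close>

lemma captured_le:
  assumes "allowed v" and V: "\<And>x y. x \<in> V \<Longrightarrow> y \<in> V \<Longrightarrow> \<bar>x - y\<bar> \<le> d"
  shows "captured V r v \<le> (4 * d) powr s / \<kappa>"
  using assms(1)
proof (induction r arbitrary: v)
  case 0
  show ?case
  proof (cases "cf_map v ` {0..1} \<subseteq> V")
    case True
    have "cyl_len v / gap (length v) \<le> cyl_len v / 1"
      using gap_ge_1[of "length v"] cyl_len_pos[OF allowed_pos[OF 0]]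
      by (intro divide_left_mono) auto
    also have "\<dots> \<le> 4 * \<bar>cf_map v 1 - cf_map v 0\<bar>"
      using cf_map_diff_ge[OF allowed_pos[OF 0], of 1 0] by simp
    also have "\<dots> \<le> 4 * d"
      using True by (intro mult_left_mono V) auto
    finally show ?thesis using True mass_le[OF 0] by simp
  qed (use \<kappa> in auto)
next
  case (Suc r)
  show ?case
  \<comment> \<open>The first branching: from here on the full mass of \<open>v\<close> is a good
    enough bound.\<close>
  proof (cases "\<exists>j\<in>D (length v). \<exists>k\<in>D (length v). j < k \<and> captured V r (j # v) \<noteq> 0 \<and> captured V r (k # v) \<noteq> 0")
    case True
    then obtain j k where jk: "j \<in> D (length v)" "k \<in> D (length v)" "j < k"
        "captured V r (j # v) \<noteq> 0" "captured V r (k # v) \<noteq> 0" by blast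
    obtain x where x: "x \<in> {1 / (B (length (j # v)) + 1)..1}" "cf_map (j # v) x \<in> V"
      using captured_nonzero_point[of "j # v" V r B, OF _ jk(4) B] jk(1) Suc.prems by auto
    obtain y where y: "y \<in> {1 / (B (length (k # v)) + 1)..1}" "cf_map (k # v) y \<in> V"
      using captured_nonzero_point[of "k # v" V r B, OF _ jk(5) B] jk(2) Suc.prems by auto
    have "0 \<le> 1 / (B (length (j # v)) + 1)" using B_ge_1[of "length (j # v)"] by simp
    then have "x \<in> {0..1}" using x(1) unfolding atLeastAtMost_iff by linarith
    then have "cyl_len v / gap (length v) \<le> 4 * \<bar>cf_map (j # v) x - cf_map (k # v) y\<bar>"
      using y by (intro children_separated Suc.prems jk) auto
    also have "\<dots> \<le> 4 * d" using V[OF x(2) y(2)] by simp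
    finally have "mass v \<le> (4 * d) powr s / \<kappa>" using mass_le Suc.prems by blast
    then show ?thesis using captured_le_mass[OF Suc.prems, of V "Suc r"] by linarith
  next
    case False
    show ?thesis
    proof (cases "\<exists>k\<in>D (length v). captured V r (k # v) \<noteq> 0")
      case True
      then obtain k where k: "k \<in> D (length v)" "captured V r (k # v) \<noteq> 0" by blast
      have "captured V r (j # v) = 0" if "j \<in> D (length v) - {k}" for j
      proof -
        have "j \<in> D (length v)" "j < k \<or> k < j" using that by auto
        then show ?thesis using False k by blast
      qed
      then have "captured V (Suc r) v = captured V r (k # v)"
        using sum.remove[OF finite_D k(1), of "\<lambda>j. captured V r (j # v)"] by simp
      then show ?thesis using Suc k by simp
    next
      case False
      then show ?thesis using \<kappa> by simp
    qed
  qed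
qed

text \<open>Plays the part of compactness of the limit set: finitely many of the open sets capture
  the total mass 1 at one common depth.\<close>

lemma finite_subcover_mass:
  assumes opn: "\<And>i::nat. open (V i)"
    and A: "\<And>a x. (\<And>n. a n \<in> D n) \<Longrightarrow> 0 < x \<Longrightarrow> x < 1 \<Longrightarrow> x \<notin> \<rat> \<Longrightarrow>
             (\<And>n. cf_digit x (Suc n) = a n) \<Longrightarrow> x \<in> (\<Union>i. V i)"
  shows "\<exists>I r. finite I \<and> 1 \<le> (\<Sum>i\<in>I. captured (V i) r [])"
proof -
  define P where "P v \<longleftrightarrow> (\<exists>I r0. finite I \<and> (\<forall>r\<ge>r0. mass v \<le> (\<Sum>i\<in>I. captured (V i) r v)))" for v
  \<comment> \<open>A fan argument: failure of \<open>P\<close> is inherited by some child, and following such children leads to a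
    point of the tree whose cylinders eventually lie inside one of the open sets.\<close>
  have P_step: "P v" if v: "allowed v" and ch: "\<And>k. k \<in> D (length v) \<Longrightarrow> P (k # v)" for v
  proof -
    have "\<forall>k\<in>D (length v). \<exists>I r0. finite I \<and> (\<forall>r\<ge>r0. mass (k # v) \<le> (\<Sum>i\<in>I. captured (V i) r (k # v)))"
      using ch unfolding P_def by blast
    then obtain I r0 where Ir: "\<And>k. k \<in> D (length v) \<Longrightarrow> finite (I k)"
        "\<And>k r. k \<in> D (length v) \<Longrightarrow> r \<ge> r0 k \<Longrightarrow> mass (k # v) \<le> (\<Sum>i\<in>I k. captured (V i) r (k # v))"
      by metis
    define J where "J = (\<Union>k\<in>D (length v). I k)"
    have J: "finite J" using Ir(1) finite_D by (auto simp: J_def)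
    \<comment> \<open>The sum of the children's thresholds dominates each of them; the successor
      accounts for the level from \<open>v\<close> to its children.\<close>
    have "mass v \<le> (\<Sum>i\<in>J. captured (V i) r v)" if r: "r \<ge> Suc (\<Sum>k\<in>D (length v). r0 k)" for r
    proof -
      obtain r' where r': "r = Suc r'" "r' \<ge> (\<Sum>k\<in>D (length v). r0 k)"
        using r by (cases r) auto
      have "mass v = (\<Sum>k\<in>D (length v). mass (k # v))"
        using sum_mass_children v by simp
      also have "\<dots> \<le> (\<Sum>k\<in>D (length v). \<Sum>i\<in>J. captured (V i) r' (k # v))"
      proof (rule sum_mono)
        fix k assume k: "k \<in> D (length v)"
        have "r0 k \<le> (\<Sum>k\<in>D (length v). r0 k)"
          using k finite_D by (intro member_le_sum) auto
        then have "mass (k # v) \<le> (\<Sum>i\<in>I k. captured (V i) r' (k # v))"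
          using Ir(2)[OF k] r'(2) by simp
        also have "\<dots> \<le> (\<Sum>i\<in>J. captured (V i) r' (k # v))"
          using k J by (intro sum_mono2) (auto simp: J_def captured_nonneg)
        finally show "mass (k # v) \<le> (\<Sum>i\<in>J. captured (V i) r' (k # v))" .
      qed
      also have "\<dots> = (\<Sum>i\<in>J. captured (V i) r v)"
        unfolding r'(1) captured.simps by (rule sum.swap)
      finally show ?thesis .
    qed
    then show ?thesis unfolding P_def using J by blast
  qed
  have "P []"
  proof (rule ccontr)
    assume nP: "\<not> P []"
    define child where "child v = (SOME k. k \<in> D (length v) \<and> \<not> P (k # v))" for v
    have child: "child v \<in> D (length v) \<and> \<not> P (child v # v)" if "allowed v" "\<not> P v" for v
      unfolding child_def by (rule someI_ex) (use P_step[of v] that in blast)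
    define w where "w = rec_nat [] (\<lambda>_ v. child v # v)"
    have w_simps: "w 0 = []" "w (Suc n) = child (w n) # w n" for n by (simp_all add: w_def)
    have "allowed (w n) \<and> \<not> P (w n)" for n
    proof (induction n)
      case 0
      show ?case using nP by (simp add: w_simps)
    next
      case (Suc n)
      then show ?case using child[of "w n"] by (simp add: w_simps)
    qed
    then have w: "allowed (w n)" "\<not> P (w n)" for n by blast+
    define a where "a n = child (w n)" for n
    have w_eq: "w n = cf_prefix a n" for n
      by (induction n) (simp_all add: w_simps a_def)
    have aD: "a n \<in> D n" for n
      using child[OF w[of n]] by (simp add: a_def w_eq)
    obtain x where x: "\<And>n. x \<in> cf_map (cf_prefix a n) ` {0..1}" "0 < x" "x < 1" "x \<notin> \<rat>"
        "\<And>n. cf_digit x (Suc n) = a n"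
      using cf_point_exists[of a] digit_ge_1[OF aD] by blast
    then obtain i where "x \<in> V i" using A[of a x] aD by blast
    then obtain e where e: "e > 0" "ball x e \<subseteq> V i"
      using opn by (meson open_contains_ball)
    have "(\<lambda>n. 2 * (1 / 2 :: real) ^ n) \<longlonglongrightarrow> 0" by real_asymp
    then have "eventually (\<lambda>n. 2 * (1 / 2 :: real) ^ n < e) sequentially"
      using e(1) by (rule order_tendstoD)
    then obtain n where n: "2 * (1 / 2 :: real) ^ n < e"
      using eventually_happens'[OF sequentially_bot] by blast
    have "cf_map (w n) ` {0..1} \<subseteq> V i"
    proof
      fix t assume "t \<in> cf_map (w n) ` {0..1}"
      then obtain u where u: "u \<in> {0..1}" "t = cf_map (w n) u" by blast
      obtain u' where u': "u' \<in> {0..1}" "x = cf_map (w n) u'" using x(1)[of n] w_eq by auto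
      have "\<bar>x - t\<bar> \<le> 2 * (1 / 2) ^ n"
        using cf_map_diff_le_half_power[OF allowed_pos[OF w(1)[of n]] u'(1) u(1)] u u' w_eq by simp
      then have "t \<in> ball x e" using n by (simp add: dist_real_def)
      then show "t \<in> V i" using e(2) by blast
    qed
    then have "mass (w n) \<le> (\<Sum>i\<in>{i}. captured (V i) r (w n))" for r
      using captured_eq_mass[OF w(1)[of n]] by simp
    then have "P (w n)" unfolding P_def by blast
    then show False using w(2) by blast
  qed
  then show ?thesis unfolding P_def by auto
qed

text \<open>Finitely many balls capture mass 1, while each captures at most a constant times its
  radius to the power \<open>s\<close>.\<close>

theorem hausdorff_measure_nonzero:
  assumes A: "\<And>a x. (\<And>n. a n \<in> D n) \<Longrightarrow> 0 < x \<Longrightarrow> x < 1 \<Longrightarrow> x \<notin> \<rat> \<Longrightarrow>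
             (\<And>n. cf_digit x (Suc n) = a n) \<Longrightarrow> x \<in> A"
  shows "hausdorff_measure s A \<noteq> 0"
proof (rule hausdorff_measure_nonzeroI[OF s_pos])
  \<comment> \<open>The 8 is the 4 of \<open>captured_le\<close> times 2, since a ball of radius
    \<open>r\<close> has diameter at most \<open>2 * r\<close>.\<close>
  show "8 powr s / \<kappa> > 0" using \<kappa> by simp
  fix x r :: "nat \<Rightarrow> real"
  assume r: "\<And>i. r i > 0" and cov: "A \<subseteq> (\<Union>i. ball (x i) (r i))"
  obtain I m where I: "finite I" "1 \<le> (\<Sum>i\<in>I. captured (ball (x i) (r i)) m [])"
  proof -
    have "\<exists>I m. finite I \<and> 1 \<le> (\<Sum>i\<in>I. captured (ball (x i) (r i)) m [])"
    proof (rule finite_subcover_mass)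
      fix a t
      assume "\<And>n. a n \<in> D n" "0 < t" "t < 1" "t \<notin> \<rat>" "\<And>n. cf_digit t (Suc n) = a n"
      then have "t \<in> A" by (rule A)
      then show "t \<in> (\<Union>i. ball (x i) (r i))" using cov by (rule rev_subsetD)
    qed simp
    then show ?thesis using that by blast
  qed
  have "captured (ball (x i) (r i)) m [] \<le> (4 * (2 * r i)) powr s / \<kappa>" for i
    by (rule captured_le) (auto simp: dist_real_def)
  also have "(4 * (2 * r i)) powr s / \<kappa> = 8 powr s / \<kappa> * r i powr s" for i
    using r[of i] by (simp add: powr_mult[symmetric])
  finally have "(\<Sum>i\<in>I. captured (ball (x i) (r i)) m []) \<le> (\<Sum>i\<in>I. 8 powr s / \<kappa> * r i powr s)"
    by (intro sum_mono)
  then show "\<exists>I. finite I \<and> 1 \<le> 8 powr s / \<kappa> * (\<Sum>i\<in>I. r i powr s)"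
    using I by (auto simp: sum_distrib_left)
qed

end

end

subsection \<open>Upper bound by cylinders of many distinct digits\<close>

text \<open>Here words list the digits in their natural order, unlike for \<open>cf_map\<close>.\<close>

definition digit_cyl :: "nat list \<Rightarrow> real set" where
  "digit_cyl w = {x. 0 < x \<and> x < 1 \<and> x \<notin> \<rat> \<and> (\<forall>i<length w. cf_digit x (Suc i) = w ! i)}"

section \<open>Cylinders seen through the Gauss map\<close>

lemma cf_digit_irrational:
  assumes "0 < x" "x < 1" "x \<notin> \<rat>"
  shows "cf_digit x 1 \<ge> 1" "x = 1 / (real (cf_digit x 1) + gauss_map x)"
proof -
  have "1 / x > 1" using assms by simp
  then have f: "\<lfloor>1 / x\<rfloor> \<ge> 1" by linarith
  then show "cf_digit x 1 \<ge> 1" unfolding cf_digit_def by simp linarith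
  have "real (cf_digit x 1) = of_int \<lfloor>1 / x\<rfloor>" using f by (simp add: cf_digit_def del: one_le_floor)
  then have "real (cf_digit x 1) + gauss_map x = 1 / x"
    by (simp add: gauss_map_def frac_def)
  then show "x = 1 / (real (cf_digit x 1) + gauss_map x)" by simp
qed

lemma cf_digit_gauss_map: "cf_digit (gauss_map x) (Suc n) = cf_digit x (Suc (Suc n))"
  by (simp add: cf_digit_def funpow_swap1)

lemma digit_cyl_Cons:
  assumes "x \<in> digit_cyl (k # w)"
  shows "k \<ge> 1" "x = 1 / (real k + gauss_map x)" "gauss_map x \<in> digit_cyl w"
proof -
  have x: "0 < x" "x < 1" "x \<notin> \<rat>" and d: "\<And>i. i < Suc (length w) \<Longrightarrow> cf_digit x (Suc i) = (k # w) ! i"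
    using assms by (auto simp: digit_cyl_def)
  have "cf_digit x 1 = k" using d[of 0] by simp
  then show "k \<ge> 1" "x = 1 / (real k + gauss_map x)"
    using cf_digit_irrational[OF x] by auto
  show "gauss_map x \<in> digit_cyl w"
    unfolding digit_cyl_def using gauss_map_irrational[OF x(3)] d[of "Suc _"]
    by (auto simp: cf_digit_gauss_map)
qed

text \<open>Prefixing the digit \<open>k\<close> contracts distances by at least the factor
  \<open>k * k\<close>.\<close>

lemma digit_cyl_dist:
  assumes "x \<in> digit_cyl w" "y \<in> digit_cyl w"
  shows "\<bar>x - y\<bar> \<le> real (prod_list w) powr -2"
  using assms
proof (induction w arbitrary: x y)
  case Nil
  then show ?case by (auto simp: digit_cyl_def)
next
  case (Cons k w)
  note x = digit_cyl_Cons[OF Cons.prems(1)] and y = digit_cyl_Cons[OF Cons.prems(2)]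
  define x' y' where "x' = gauss_map x" and "y' = gauss_map y"
  have pos: "x' > 0" "y' > 0" using x(3) y(3) by (auto simp: digit_cyl_def x'_def y'_def)
  have k: "real k \<ge> 1" using x(1) by simp
  have IH: "\<bar>x' - y'\<bar> \<le> real (prod_list w) powr -2"
    unfolding x'_def y'_def by (rule Cons.IH[OF x(3) y(3)])
  have "x - y = 1 / (real k + x') - 1 / (real k + y')"
    using x(2) y(2) by (simp add: x'_def y'_def)
  also have "\<dots> = (y' - x') / ((real k + x') * (real k + y'))"
    using pos k by (simp add: field_simps)
  finally have "\<bar>x - y\<bar> = \<bar>x' - y'\<bar> / ((real k + x') * (real k + y'))"
    using pos k by (simp add: abs_mult abs_minus_commute)
  also have "\<dots> \<le> real (prod_list w) powr -2 / (real k * real k)"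
    using pos k IH by (intro frac_le mult_mono) auto
  also have "\<dots> = real (prod_list (k # w)) powr -2"
    using k by (simp add: powr_mult powr_minus powr_numeral power2_eq_square divide_inverse)
  finally show ?case .
qed

lemma diameter_digit_cyl:
  shows "bounded (digit_cyl w)" "diameter (digit_cyl w) \<le> real (prod_list w) powr -2"
proof -
  have "digit_cyl w \<subseteq> {0..1}" by (auto simp: digit_cyl_def)
  then show "bounded (digit_cyl w)" using bounded_closed_interval bounded_subset by blast
  show "diameter (digit_cyl w) \<le> real (prod_list w) powr -2"
    by (rule diameter_le) (use digit_cyl_dist in \<open>auto simp: dist_real_def norm_minus_commute\<close>)
qed

text \<open>The maximum of a set of positive integers is at least its cardinality; removing it gives
  the induction.\<close>

lemma fact_card_le_prod:
  fixes S :: "nat set"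
  assumes "finite S" "0 \<notin> S"
  shows "fact (card S) \<le> \<Prod>S"
  using assms
proof (induction "card S" arbitrary: S)
  case 0
  then show ?case by simp
next
  case (Suc n)
  then have ne: "S \<noteq> {}" by auto
  define m where "m = Max S"
  have m: "m \<in> S" using Suc ne by (simp add: m_def)
  have "S \<subseteq> {1..m}"
    using Suc.prems by (auto simp: m_def Suc_le_eq intro: gr0I)
  then have "card S \<le> m" using card_mono[of "{1..m}" S] by simp
  moreover have "fact (card (S - {m})) \<le> \<Prod>(S - {m})"
    using Suc m by (intro Suc.hyps(1)) auto
  ultimately have "card S * fact (card (S - {m})) \<le> m * \<Prod>(S - {m})" by (rule mult_le_mono)
  moreover have "\<Prod>S = m * \<Prod>(S - {m})" using Suc.prems m by (simp add: prod.remove)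
  moreover have "fact (card S) = card S * fact (card (S - {m}))"
    using Suc.hyps(2) m Suc.prems by (simp flip: Suc.hyps(2))
  ultimately show ?case by simp
qed

lemma prod_set_le_prod_list:
  fixes w :: "nat list"
  assumes "0 \<notin> set w"
  shows "\<Prod>(set w) \<le> prod_list w"
  using assms
proof (induction w)
  case (Cons k w)
  show ?case
  proof (cases "k \<in> set w")
    case True
    then have "\<Prod>(set (k # w)) \<le> 1 * prod_list w" using Cons by (simp add: insert_absorb)
    also have "\<dots> \<le> k * prod_list w" using Cons.prems by (intro mult_right_mono) auto
    finally show ?thesis by simp
  next
    case False
    then show ?thesis using Cons by simp
  qed
qed simp

text \<open>Writing sums over infinitely many words as integrals over counting measures lets
  Tonelli's theorem split off the first digit.\<close>

lemma nn_integral_prod_list: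
  fixes f :: "nat \<Rightarrow> ennreal"
  shows "(\<integral>\<^sup>+w. (\<Prod>k\<leftarrow>w. f k) \<partial>count_space {w. length w = n}) = (\<Sum>k. f k) ^ n"
proof (induction n)
  case 0
  have "{w::nat list. length w = 0} = {[]}" by auto
  then show ?case by (simp add: nn_integral_count_space_finite)
next
  case (Suc n)
  let ?L = "\<lambda>n. {w::nat list. length w = n}"
  have "bij_betw (\<lambda>(k, w). k # w) (UNIV \<times> ?L n) (?L (Suc n))"
    by (rule bij_betwI[where g = "\<lambda>w. (hd w, tl w)"]) (auto simp: length_Suc_conv)
  then have "(\<integral>\<^sup>+w. (\<Prod>k\<leftarrow>w. f k) \<partial>count_space (?L (Suc n))) =
      (\<integral>\<^sup>+p. (\<Prod>k\<leftarrow>(case p of (k, w) \<Rightarrow> k # w). f k) \<partial>count_space (UNIV \<times> ?L n))"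
    by (rule nn_integral_bij_count_space[symmetric])
  also have "\<dots> = (\<integral>\<^sup>+p. f (fst p) * (\<Prod>k\<leftarrow>snd p. f k) * indicator (UNIV \<times> ?L n) p \<partial>count_space UNIV)"
    by (subst nn_integral_count_space_indicator) (auto intro!: nn_integral_cong simp: mult.commute)
  also have "\<dots> = (\<integral>\<^sup>+k. \<integral>\<^sup>+w. f k * (\<Prod>k\<leftarrow>w. f k) * indicator (UNIV \<times> ?L n) (k, w)
      \<partial>count_space UNIV \<partial>count_space UNIV)"
    by (subst nn_integral_fst_count_space[symmetric]) simp
  also have "\<dots> = (\<integral>\<^sup>+k. f k * (\<integral>\<^sup>+w. (\<Prod>k\<leftarrow>w. f k) * indicator (?L n) w \<partial>count_space UNIV) \<partial>count_space UNIV)"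
    by (subst nn_integral_cmult[symmetric]) (auto intro!: nn_integral_cong simp: mult.assoc indicator_def)
  also have "(\<integral>\<^sup>+w. (\<Prod>k\<leftarrow>w. f k) * indicator (?L n) w \<partial>count_space UNIV) = (\<Sum>k. f k) ^ n"
    by (subst nn_integral_count_space_indicator[symmetric]) (auto simp: Suc)
  also have "(\<integral>\<^sup>+k. f k * (\<Sum>k. f k) ^ n \<partial>count_space UNIV) = (\<Sum>k. f k) ^ Suc n"
    by (simp add: nn_integral_multc nn_integral_count_space_nat)
  finally show ?case .
qed

text \<open>Covers are indexed by natural numbers, whereas the estimates go by word length; this
  regroups the sum.\<close>

lemma suminf_list_decode:
  fixes g :: "nat list \<Rightarrow> ennreal"
  shows "(\<Sum>i. g (list_decode i)) = (\<Sum>n. \<integral>\<^sup>+w. g w \<partial>count_space {w. length w = n})"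
proof -
  have "(\<Sum>i. g (list_decode i)) = (\<integral>\<^sup>+i. g (list_decode i) \<partial>count_space UNIV)"
    by (simp add: nn_integral_count_space_nat)
  also have "\<dots> = (\<integral>\<^sup>+w. g w \<partial>count_space UNIV)"
    by (rule nn_integral_bij_count_space[OF bij_list_decode])
  also have "\<dots> = (\<integral>\<^sup>+w. (\<Sum>n. g w * indicator {w. length w = n} w) \<partial>count_space UNIV)"
  proof (intro nn_integral_cong)
    fix w
    have "(\<Sum>n. g w * indicator {w. length w = n} w) = (\<Sum>n\<in>{length w}. g w * indicator {w. length w = n} w)"
      by (rule suminf_finite) auto
    then show "g w = (\<Sum>n. g w * indicator {w. length w = n} w)" by simp
  qed
  also have "\<dots> = (\<Sum>n. \<integral>\<^sup>+w. g w * indicator {w. length w = n} w \<partial>count_space UNIV)"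
    by (rule nn_integral_suminf) simp
  also have "\<dots> = (\<Sum>n. \<integral>\<^sup>+w. g w \<partial>count_space {w. length w = n})"
    by (intro suminf_cong nn_integral_count_space_indicator[symmetric]) auto
  finally show ?thesis .
qed

lemma eventually_power_le_fact:
  fixes X :: real
  shows "eventually (\<lambda>m. X ^ m \<le> fact m) sequentially"
proof -
  have "(\<lambda>m. X ^ m / fact m) \<longlonglongrightarrow> 0"
    using summable_LIMSEQ_zero[OF summable_exp[of X]] by (simp add: divide_inverse mult.commute)
  then have "eventually (\<lambda>m. X ^ m / fact m < 1) sequentially"
    by (rule order_tendstoD) simp
  then show ?thesis by eventually_elim (simp add: divide_less_eq)
qed

lemma ennreal_prod_list_powr:
  "ennreal (real (prod_list w) powr t) = (\<Prod>k\<leftarrow>w. ennreal (real k powr t))"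
  by (induction w) (auto simp: powr_mult ennreal_mult)

text \<open>The exponent \<open>2 * s\<close> is split into \<open>2 * t\<close>, which makes the
  sum over all words converge, and \<open>\<gamma>\<close>, which turns the factorial bound into
  decay beating any exponential in the word length.\<close>

lemma hausdorff_measure_many_digits_eq_0:
  assumes s: "s > 1 / 2" and c: "c > 0"
    and A: "\<And>x. x \<in> A \<Longrightarrow> 0 < x \<and> x < 1 \<and> x \<notin> \<rat> \<and>
              eventually (\<lambda>n. c * real n \<le> real (R_count n x)) sequentially"
  shows "hausdorff_measure s A = 0"
proof (rule hausdorff_measure_eq_0I)
  show "s > 0" using s by simp
  fix \<epsilon> :: real assume \<epsilon>: "\<epsilon> > 0"
  define t where "t = (s + 1 / 2) / 2"
  define \<gamma> where "\<gamma> = 2 * (s - t)"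
  have t: "2 * t > 1" "t < s" and \<gamma>: "\<gamma> > 0" using s by (auto simp: t_def \<gamma>_def)
  \<comment> \<open>The term \<open>k = 0\<close> vanishes because \<open>0 powr\<close> anything is
    0.\<close>
  define \<zeta> where "\<zeta> = (\<Sum>k. real k powr (- 2 * t))"
  have summable: "summable (\<lambda>k. real k powr (- 2 * t))"
    using t by (simp add: summable_real_powr_iff)
  have "(\<Sum>k\<in>{1::nat}. real k powr (- 2 * t)) \<le> \<zeta>"
    unfolding \<zeta>_def by (intro sum_le_suminf summable) auto
  then have \<zeta>: "\<zeta> \<ge> 1" by simp
  have \<zeta>_eq: "(\<Sum>k. ennreal (real k powr (- 2 * t))) = ennreal \<zeta>"
    unfolding \<zeta>_def by (intro suminf_ennreal2 summable) auto
  \<comment> \<open>Chosen so that \<open>X powr (\<gamma> * c)\<close> is at least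
    \<open>2 * \<zeta>\<close>; the maximum with 1 makes powers of \<open>X\<close> monotone in the
    exponent.\<close>
  define X where "X = max 1 ((2 * \<zeta>) powr (1 / (\<gamma> * c)))"
  obtain m0 where m0: "\<And>m. m \<ge> m0 \<Longrightarrow> X ^ m \<le> fact m"
    using eventually_power_le_fact[of X] by (auto simp: eventually_sequentially)
  \<comment> \<open>The first condition makes words of length at least \<open>N\<close> have enough
    distinct digits for \<open>m0\<close>, the second makes the tail of the geometric series
    small.\<close>
  obtain N where N: "real N * c \<ge> real m0" "(1 / 2) ^ N < \<epsilon> / 2"
  proof -
    obtain N1 where N1: "real N1 * c \<ge> real m0" using c reals_Archimedean3 less_imp_le by blast
    obtain N2 where N2: "(1 / 2) ^ N2 < \<epsilon> / 2" using real_arch_pow_inv[of "\<epsilon> / 2" "1 / 2"] \<epsilon> by auto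
    have "real N1 * c \<le> real (N1 + N2) * c" using c by simp
    moreover have "(1 / 2 :: real) ^ (N1 + N2) \<le> (1 / 2) ^ N2" by (intro power_decreasing) auto
    ultimately show ?thesis using that[of "N1 + N2"] N1 N2 by linarith
  qed
  define good where "good w \<longleftrightarrow> length w \<ge> N \<and> 0 \<notin> set w \<and> c * real (length w) \<le> real (card (set w))" for w :: "nat list"
  define U where "U w = (if good w then digit_cyl w else {})" for w
  \<comment> \<open>With this weight, the words of length \<open>n\<close> contribute
    \<open>C n * \<zeta> ^ n\<close>, which is (1/2)^n from \<open>N\<close> on.\<close>
  define C where "C n = (if n \<ge> N then 1 / (2 * \<zeta>) ^ n else 0)" for n
  have C: "C n \<ge> 0" for n using \<zeta> by (simp add: C_def)
  have U_diam: "diameter (U w) powr s \<le> C (length w) * real (prod_list w) powr (- 2 * t)" for w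
  proof (cases "good w")
    case False
    then show ?thesis using C s by (simp add: U_def)
  next
    case True
    define n m p where "n = length w" and "m = card (set w)" and "p = real (prod_list w)"
    have n: "n \<ge> N" "0 \<notin> set w" "c * real n \<le> real m"
      using True by (auto simp: good_def n_def m_def)
    have "real N * c \<le> real n * c" using n(1) c by simp
    then have "m \<ge> m0" using N(1) n(3) by (simp add: mult.commute)
    then have Xm: "X ^ m \<le> fact m" by (rule m0)
    have X: "X \<ge> 1" by (simp add: X_def)
    have "fact m \<le> prod_list w"
      using fact_card_le_prod[of "set w"] prod_set_le_prod_list[OF n(2)] n(2) by (simp add: m_def)
    then have fp: "fact m \<le> p" unfolding p_def by (metis of_nat_fact of_nat_le_iff)
    have p: "p > 0" using fp fact_gt_zero[of m, where ?'a = real] by linarith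
    have "(2 * \<zeta>) ^ n = (2 * \<zeta>) powr real n" using \<zeta> by (simp add: powr_realpow)
    also have "\<dots> = ((2 * \<zeta>) powr (1 / (\<gamma> * c))) powr (\<gamma> * c * real n)"
      using c \<gamma> by (simp add: powr_powr)
    also have "\<dots> \<le> X powr (\<gamma> * c * real n)"
      using c \<gamma> by (intro powr_mono2) (auto simp: X_def)
    also have "\<dots> \<le> X powr (\<gamma> * real m)"
      using X n(3) \<gamma> by (intro powr_mono) (auto simp: mult.assoc)
    also have "\<dots> = (X ^ m) powr \<gamma>"
      using X by (simp add: powr_realpow[symmetric] powr_powr mult.commute)
    also have "\<dots> \<le> p powr \<gamma>"
      using Xm fp X \<gamma> by (intro powr_mono2) auto
    finally have "1 / p powr \<gamma> \<le> 1 / (2 * \<zeta>) ^ n"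
      using \<zeta> p by (intro divide_left_mono) auto
    then have Cn: "p powr (- \<gamma>) \<le> C n"
      using n(1) by (simp add: C_def powr_minus_divide)
    have "diameter (U w) powr s \<le> (p powr -2) powr s"
      using True diameter_digit_cyl[of w] s diameter_ge_0[OF diameter_digit_cyl(1)[of w]]
      by (intro powr_mono2) (auto simp: U_def p_def)
    also have "\<dots> = p powr (- \<gamma>) * p powr (- 2 * t)"
      by (simp add: powr_powr powr_add[symmetric] \<gamma>_def algebra_simps)
    also have "\<dots> \<le> C n * p powr (- 2 * t)"
      by (intro mult_right_mono Cn) simp
    finally show ?thesis by (simp add: n_def p_def)
  qed
  have "A \<subseteq> (\<Union>i. U (list_decode i))"
  proof
    fix x assume "x \<in> A"
    then have x: "0 < x" "x < 1" "x \<notin> \<rat>"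
      and ev: "eventually (\<lambda>n. c * real n \<le> real (R_count n x)) sequentially"
      using A by auto
    obtain n where n: "n \<ge> N" "c * real n \<le> real (R_count n x)"
      using eventually_happens'[OF sequentially_bot eventually_conj[OF eventually_ge_at_top[of N] ev]] by blast
    define w where "w = map (\<lambda>i. cf_digit x (Suc i)) [0..<n]"
    have orbit: "(gauss_map ^^ i) x \<notin> \<rat> \<and> 0 < (gauss_map ^^ i) x \<and> (gauss_map ^^ i) x < 1" for i
      by (induction i) (use x gauss_map_irrational in auto)
    have digit: "cf_digit x (Suc i) \<ge> 1" for i
      using cf_digit_irrational(1)[of "(gauss_map ^^ i) x"] orbit[of i] by (simp add: cf_digit_def)
    have "set w = cf_digit x ` {1..n}"
      by (auto simp: w_def image_iff Bex_def) (metis Suc_le_D Suc_le_eq)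
    then have "card (set w) = R_count n x" by (simp add: R_count_def)
    moreover have "0 \<notin> set w"
    proof
      assume "0 \<in> set w"
      then obtain i where "cf_digit x (Suc i) = 0" by (auto simp: w_def)
      then show False using digit[of i] by simp
    qed
    ultimately have "good w" using n by (simp add: good_def w_def)
    moreover have "x \<in> digit_cyl w" using x by (simp add: digit_cyl_def w_def)
    ultimately have "x \<in> U (list_decode (list_encode w))" by (simp add: U_def)
    then show "x \<in> (\<Union>i. U (list_decode i))" by blast
  qed
  moreover have "bounded (U w)" for w by (simp add: U_def diameter_digit_cyl)
  moreover have "(\<Sum>i. ennreal (diameter (U (list_decode i)) powr s)) \<le> ennreal \<epsilon>"
  proof -
    have "(\<Sum>i. ennreal (diameter (U (list_decode i)) powr s)) =
        (\<Sum>n. \<integral>\<^sup>+w. ennreal (diameter (U w) powr s) \<partial>count_space {w. length w = n})"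
      by (rule suminf_list_decode)
    also have "\<dots> \<le> (\<Sum>n. ennreal (C n * \<zeta> ^ n))"
    proof (intro suminf_le summableI)
      fix n
      have "(\<integral>\<^sup>+w. ennreal (diameter (U w) powr s) \<partial>count_space {w. length w = n}) \<le>
          (\<integral>\<^sup>+w. ennreal (C n) * (\<Prod>k\<leftarrow>w. ennreal (real k powr (- 2 * t))) \<partial>count_space {w. length w = n})"
      proof (intro nn_integral_mono)
        fix w assume "w \<in> space (count_space {w :: nat list. length w = n})"
        then have "diameter (U w) powr s \<le> C n * real (prod_list w) powr (- 2 * t)"
          using U_diam[of w] by simp
        then have "ennreal (diameter (U w) powr s) \<le> ennreal (C n) * ennreal (real (prod_list w) powr (- 2 * t))"
          using C by (simp add: ennreal_mult[symmetric] ennreal_leI)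
        then show "ennreal (diameter (U w) powr s) \<le> ennreal (C n) * (\<Prod>k\<leftarrow>w. ennreal (real k powr (- 2 * t)))"
          unfolding ennreal_prod_list_powr .
      qed
      also have "\<dots> = ennreal (C n) * ennreal \<zeta> ^ n"
        by (simp only: nn_integral_cmult[OF borel_measurable_count_space] nn_integral_prod_list \<zeta>_eq)
      also have "\<dots> = ennreal (C n * \<zeta> ^ n)"
        using C \<zeta> by (simp add: ennreal_mult ennreal_power)
      finally show "(\<integral>\<^sup>+w. ennreal (diameter (U w) powr s) \<partial>count_space {w. length w = n}) \<le>
          ennreal (C n * \<zeta> ^ n)" .
    qed
    also have "\<dots> = ennreal (2 * (1 / 2) ^ N)"
    proof (rule suminf_ennreal_eq)
      have "(\<lambda>n. (1 / 2 :: real) ^ N * (1 / 2) ^ n) sums ((1 / 2) ^ N * (1 / (1 - 1 / 2)))"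
        by (intro sums_mult geometric_sums) simp
      then have "(\<lambda>n. C (n + N) * \<zeta> ^ (n + N)) sums (2 * (1 / 2) ^ N)"
        using \<zeta> by (simp add: C_def power_mult_distrib power_add[symmetric] add.commute power_one_over[symmetric] mult.commute)
      then show "(\<lambda>n. C n * \<zeta> ^ n) sums (2 * (1 / 2) ^ N)"
        by (subst (asm) sums_iff_shift) (auto simp: C_def)
    qed (use C \<zeta> in auto)
    also have "\<dots> \<le> ennreal \<epsilon>" using N(2) by (intro ennreal_leI) linarith
    finally show ?thesis .
  qed
  ultimately show "\<exists>U :: nat \<Rightarrow> real set. A \<subseteq> (\<Union>i. U i) \<and> (\<forall>i. bounded (U i)) \<and>
                (\<Sum>i. ennreal (diameter (U i) powr s)) \<le> ennreal \<epsilon>"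
    by (intro exI[of _ "\<lambda>i. U (list_decode i)"]) auto
qed

subsection \<open>Digit sets with a prescribed number of distinct values\<close>

text \<open>The floor of a nondecreasing function with increments at most 1 moves in steps of 0 or
  1. Shifting the argument by \<open>N\<close> reaches the range of small increments, and
  subtracting the initial value gives \<open>h 0 = 0\<close>; neither changes the limit.\<close>

lemma floor_counting_function:
  fixes \<beta> c :: real
  assumes \<beta>: "\<beta> > 0" and c: "c > 0"
    and N: "\<And>n. n \<ge> N \<Longrightarrow> c * (real (Suc n) powr \<beta> - real n powr \<beta>) \<le> 1"
  obtains h :: "nat \<Rightarrow> nat" where "h 0 = 0" "\<And>n. h (Suc n) = h n \<or> h (Suc n) = Suc (h n)"
    "(\<lambda>n. real (h n) / real n powr \<beta>) \<longlonglongrightarrow> c"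
proof -
  define g where "g n = nat \<lfloor>c * real (n + N) powr \<beta>\<rfloor>" for n
  have g_bounds: "real (g n) \<le> c * real (n + N) powr \<beta>" "c * real (n + N) powr \<beta> < real (g n) + 1" for n
  proof -
    have "0 \<le> c * real (n + N) powr \<beta>" using c by simp
    then show "real (g n) \<le> c * real (n + N) powr \<beta>" "c * real (n + N) powr \<beta> < real (g n) + 1"
      by (auto simp: g_def)
  qed
  have g_step: "g n \<le> g (Suc n)" "g (Suc n) \<le> Suc (g n)" for n
  proof -
    have "real (n + N) powr \<beta> \<le> real (Suc n + N) powr \<beta>"
      using \<beta> by (intro powr_mono2) auto
    then have "c * real (n + N) powr \<beta> \<le> c * real (Suc n + N) powr \<beta>" using c by simp
    then have "real (g n) < real (g (Suc n)) + 1"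
      using g_bounds[of n] g_bounds[of "Suc n"] by linarith
    then show "g n \<le> g (Suc n)" by linarith
    have "real (g (Suc n)) < real (g n) + 2"
      using g_bounds[of n] g_bounds[of "Suc n"] N[of "n + N"] by (simp add: algebra_simps)
    then show "g (Suc n) \<le> Suc (g n)" by linarith
  qed
  have g0: "g 0 \<le> g n" for n
    by (induction n) (use g_step(1) order_trans in auto)
  show ?thesis
  proof (rule that[of "\<lambda>n. g n - g 0"])
    show "g (Suc n) - g 0 = g n - g 0 \<or> g (Suc n) - g 0 = Suc (g n - g 0)" for n
      using g_step[of n] g0[of n] by linarith
    show "(\<lambda>n. real (g n - g 0) / real n powr \<beta>) \<longlonglongrightarrow> c"
    proof (rule tendsto_sandwich)
      show "(\<lambda>n. (c * (real n + real N) powr \<beta> - (1 + real (g 0))) / real n powr \<beta>) \<longlonglongrightarrow> c"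
        using \<beta> by real_asymp
      show "(\<lambda>n. c * (real n + real N) powr \<beta> / real n powr \<beta>) \<longlonglongrightarrow> c"
        using \<beta> by real_asymp
      show "\<forall>\<^sub>F n in sequentially. (c * (real n + real N) powr \<beta> - (1 + real (g 0))) / real n powr \<beta>
          \<le> real (g n - g 0) / real n powr \<beta>"
      proof (intro always_eventually allI divide_right_mono)
        fix n
        show "c * (real n + real N) powr \<beta> - (1 + real (g 0)) \<le> real (g n - g 0)"
          using g_bounds(2)[of n] g0[of n] by (simp add: of_nat_diff)
      qed simp
      show "\<forall>\<^sub>F n in sequentially. real (g n - g 0) / real n powr \<beta> \<le>
          c * (real n + real N) powr \<beta> / real n powr \<beta>"
      proof (intro always_eventually allI divide_right_mono)
        fix n
        show "real (g n - g 0) \<le> c * (real n + real N) powr \<beta>"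
          using g_bounds(1)[of n] g0[of n] by (simp add: of_nat_diff)
      qed simp
    qed
  qed simp
qed

lemma sublinear_counting_function:
  fixes \<beta> c :: real
  assumes "0 < \<beta>" "\<beta> < 1" "c > 0"
  obtains h :: "nat \<Rightarrow> nat" where "h 0 = 0" "\<And>n. h (Suc n) = h n \<or> h (Suc n) = Suc (h n)"
    "(\<lambda>n. real (h n) / real n powr \<beta>) \<longlonglongrightarrow> c"
proof -
  have "(\<lambda>n. c * ((real n + 1) powr \<beta> - real n powr \<beta>)) \<longlonglongrightarrow> 0"
    using assms by real_asymp
  then have "eventually (\<lambda>n. c * ((real n + 1) powr \<beta> - real n powr \<beta>) < 1) sequentially"
    by (rule order_tendstoD) simp
  then obtain N where "\<And>n. n \<ge> N \<Longrightarrow> c * ((real n + 1) powr \<beta> - real n powr \<beta>) < 1"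
    by (auto simp: eventually_sequentially)
  then have "c * (real (Suc n) powr \<beta> - real n powr \<beta>) \<le> 1" if "n \<ge> N" for n
    using that by (force simp: add.commute intro: less_imp_le)
  then show ?thesis using floor_counting_function[of \<beta> c N] assms that by blast
qed

text \<open>For exponent 1 every increment equals \<open>c\<close>, so the bound
  \<open>c \<le> 1\<close> is what permits steps of at most 1.\<close>

lemma linear_counting_function:
  fixes c :: real
  assumes "0 < c" "c \<le> 1"
  obtains h :: "nat \<Rightarrow> nat" where "h 0 = 0" "\<And>n. h (Suc n) = h n \<or> h (Suc n) = Suc (h n)"
    "(\<lambda>n. real (h n) / real n powr 1) \<longlonglongrightarrow> c"
  by (rule floor_counting_function[of 1 c 0]) (use assms that in \<open>auto simp: algebra_simps\<close>)

section \<open>Digit sequences that follow a counting function\<close>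

context
  fixes h :: "nat \<Rightarrow> nat"
  assumes h0: "h 0 = 0" and h_step: "\<And>n. h (Suc n) = h n \<or> h (Suc n) = Suc (h n)"
begin

lemma counting_le: "h n \<le> n"
proof (induction n)
  case (Suc n)
  then show ?case using h_step[of n] by linarith
qed (simp add: h0)

text \<open>\<open>r\<close> recovers from a new digit the value of \<open>h\<close> at its jump, so
  digits of different jumps differ. The other digits take at most \<open>M\<close> values
  altogether.\<close>

lemma R_count_bounds:
  assumes new: "\<And>n. h (Suc n) \<noteq> h n \<Longrightarrow> r (cf_digit x (Suc n)) = h (Suc n)"
    and old: "\<And>n. h (Suc n) = h n \<Longrightarrow> cf_digit x (Suc n) \<in> {1..M}"
  shows "h n \<le> R_count n x" "R_count n x \<le> h n + M"
proof -
  let ?S = "\<lambda>n. cf_digit x ` {1..n}"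
  have S_Suc: "?S (Suc n) = insert (cf_digit x (Suc n)) (?S n)" for n
    by (simp add: atLeastAtMostSuc_conv)
  have "{1..h n} \<subseteq> r ` ?S n"
  proof (induction n)
    case (Suc n)
    show ?case
    proof (cases "h (Suc n) = h n")
      case True
      then show ?thesis using Suc unfolding S_Suc by auto
    next
      case False
      then have "{1..h (Suc n)} = insert (h (Suc n)) {1..h n}"
        using h_step[of n] by (simp add: atLeastAtMostSuc_conv)
      then show ?thesis using Suc new[OF False] unfolding S_Suc by auto
    qed
  qed (simp add: h0)
  then have "card {1..h n} \<le> card (r ` ?S n)" by (intro card_mono) auto
  also have "\<dots> \<le> card (?S n)" by (intro card_image_le) auto
  finally show "h n \<le> R_count n x" by (simp add: R_count_def)
  \<comment> \<open>With \<open>{1..M}\<close> included from the start, only jumps can increase the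
    count.\<close>
  have "card (?S n \<union> {1..M}) \<le> h n + M"
  proof (induction n)
    case (Suc n)
    show ?case
    proof (cases "h (Suc n) = h n")
      case True
      then have "?S (Suc n) \<union> {1..M} = ?S n \<union> {1..M}"
        using old[OF True] unfolding S_Suc by blast
      then show ?thesis using Suc True by simp
    next
      case False
      then have "card (?S (Suc n) \<union> {1..M}) \<le> Suc (card (?S n \<union> {1..M}))"
        unfolding S_Suc by (simp add: card_insert_if)
      then show ?thesis using Suc False h_step[of n] by simp
    qed
  qed (simp add: h0)
  then show "R_count n x \<le> h n + M"
    unfolding R_count_def using card_mono[of "?S n \<union> {1..M}" "?S n"] by simp
qed

lemma E_set_memI:
  assumes \<beta>: "\<beta> > 0" and lim: "(\<lambda>n. real (h n) / real n powr \<beta>) \<longlonglongrightarrow> c"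
    and x: "0 < x" "x < 1" "x \<notin> \<rat>"
    and new: "\<And>n. h (Suc n) \<noteq> h n \<Longrightarrow> r (cf_digit x (Suc n)) = h (Suc n)"
    and old: "\<And>n. h (Suc n) = h n \<Longrightarrow> cf_digit x (Suc n) \<in> {1..M}"
  shows "x \<in> E_set \<beta> c"
proof -
  note R = R_count_bounds[of r x M, OF new old]
  have "(\<lambda>n. real (R_count n x) / real n powr \<beta>) \<longlonglongrightarrow> c"
  proof (rule tendsto_sandwich[OF _ _ lim])
    have "(\<lambda>n. real M / real n powr \<beta>) \<longlonglongrightarrow> 0" using \<beta> by real_asymp
    then show "(\<lambda>n. real (h n) / real n powr \<beta> + real M / real n powr \<beta>) \<longlonglongrightarrow> c"
      using tendsto_add[OF lim, of _ 0] by simp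
    show "\<forall>\<^sub>F n in sequentially. real (h n) / real n powr \<beta> \<le> real (R_count n x) / real n powr \<beta>"
      using R(1) by (intro always_eventually allI divide_right_mono) auto
    show "\<forall>\<^sub>F n in sequentially. real (R_count n x) / real n powr \<beta> \<le>
        real (h n) / real n powr \<beta> + real M / real n powr \<beta>"
    proof (intro always_eventually allI)
      fix n
      have "real (R_count n x) \<le> real (h n) + real M" using R(2)[of n] by linarith
      then show "real (R_count n x) / real n powr \<beta> \<le> real (h n) / real n powr \<beta> + real M / real n powr \<beta>"
        unfolding add_divide_distrib[symmetric] by (rule divide_right_mono) simp
    qed
  qed
  then show ?thesis using x by (simp add: E_set_def)
qed

end

text \<open>Turns an asymptotic comparison into the constant \<open>\<kappa>\<close> of the growth
  condition; the finitely many early ratios are handled by a minimum.\<close>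

lemma ex_uniform_lower_bound:
  fixes f g :: "nat \<Rightarrow> real"
  assumes "\<And>n. f n > 0" "\<And>n. g n > 0" "eventually (\<lambda>n. g n \<le> f n) sequentially"
  shows "\<exists>\<kappa>>0. \<forall>n. \<kappa> * g n \<le> f n"
proof -
  obtain N where N: "\<And>n. n \<ge> N \<Longrightarrow> g n \<le> f n"
    using assms(3) by (auto simp: eventually_sequentially)
  define \<kappa> where "\<kappa> = Min (insert 1 ((\<lambda>n. f n / g n) ` {..<N}))"
  have "\<kappa> > 0" unfolding \<kappa>_def using assms by (subst Min_gr_iff) auto
  moreover have "\<kappa> * g n \<le> f n" for n
  proof (cases "n < N")
    case True
    then have "\<kappa> \<le> f n / g n" unfolding \<kappa>_def by (intro Min_le) auto
    then show ?thesis using assms(2)[of n] by (simp add: field_simps)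
  next
    case False
    have "\<kappa> \<le> 1" unfolding \<kappa>_def by (intro Min_le) auto
    then have "\<kappa> * g n \<le> 1 * g n" using assms(2)[of n] by (intro mult_right_mono) auto
    then show ?thesis using N[of n] False by simp
  qed
  ultimately show ?thesis by blast
qed

lemma cyl_len_Cons_powr_ge:
  assumes "0 \<notin> set v" "1 \<le> k" "real k \<le> b" "0 < s"
  shows "cyl_len v powr s * (1 / (3 * b\<^sup>2)) powr s \<le> cyl_len (k # v) powr s"
proof -
  have k: "real k \<ge> 1" using assms by simp
  have l: "cyl_len v > 0" by (rule cyl_len_pos[OF assms(1)])
  have "cyl_len v / (3 * b\<^sup>2) \<le> cyl_len v / (3 * (real k)\<^sup>2)"
    using k assms(3) l by (intro divide_left_mono mult_left_mono power_mono mult_pos_pos) auto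
  also have "\<dots> \<le> cyl_len (k # v)" by (rule cyl_len_Cons_ge[OF assms(1,2)])
  finally have "(cyl_len v * (1 / (3 * b\<^sup>2))) powr s \<le> cyl_len (k # v) powr s"
    using l assms by (intro powr_mono2) auto
  then show ?thesis using l by (simp add: powr_mult[symmetric])
qed

text \<open>As \<open>s - 1\<close> is negative and each child is at most half as long as its
  parent, the power of a child's length is at least \<open>(cyl_len v / 2) powr (s - 1)\<close>
  times that length. The lengths are then summed by \<open>sum_cyl_len_Cons\<close>.\<close>

lemma sum_cyl_len_powr_ge:
  assumes v: "0 \<notin> set v" and s: "s < 1"
  shows "2 powr (1 - s) * (1 - 2 / (real M + 2)) * cyl_len v powr s \<le> (\<Sum>k=1..M. cyl_len (k # v) powr s)"
proof -
  have l: "cyl_len v > 0" by (rule cyl_len_pos[OF v])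
  have *: "(cyl_len v / 2) powr (s - 1) * cyl_len (k # v) \<le> cyl_len (k # v) powr s" if "k \<in> {1..M}" for k
  proof -
    have lk: "cyl_len (k # v) > 0" using that v by (intro cyl_len_pos) auto
    have "(cyl_len v / 2) powr (s - 1) \<le> cyl_len (k # v) powr (s - 1)"
      using that s lk cyl_len_Cons_le_half[OF v, of k] by (intro powr_mono2') auto
    then have "(cyl_len v / 2) powr (s - 1) * cyl_len (k # v) \<le> cyl_len (k # v) powr (s - 1) * cyl_len (k # v)"
      using lk by (intro mult_right_mono) auto
    also have "\<dots> = cyl_len (k # v) powr s" using lk by (simp add: powr_diff)
    finally show ?thesis .
  qed
  have "2 powr (1 - s) * (1 - 2 / (real M + 2)) * cyl_len v powr s =
      (cyl_len v / 2) powr (s - 1) * ((1 - 2 / (real M + 2)) * cyl_len v)"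
    using l by (simp add: powr_divide powr_diff)
  also have "\<dots> \<le> (cyl_len v / 2) powr (s - 1) * (\<Sum>k=1..M. cyl_len (k # v))"
    using sum_cyl_len_Cons[OF v] by (intro mult_left_mono) auto
  also have "\<dots> \<le> (\<Sum>k=1..M. cyl_len (k # v) powr s)"
    unfolding sum_distrib_left by (intro sum_mono *)
  finally show ?thesis .
qed

lemma le_powr_of_le_1:
  fixes a s :: real
  assumes "0 < a" "a \<le> 1" "s \<le> 1"
  shows "a \<le> a powr s"
  using powr_mono'[of s 1 a] assms by simp

lemma powr_le_of_ge_1:
  fixes a s :: real
  assumes "1 \<le> a" "s \<le> 1"
  shows "a powr s \<le> a"
  using powr_mono[of s 1 a] assms by simp

subsection \<open>Dimension of the level sets\<close>

lemma hausdorff_measure_E_set_nonzero: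
  assumes \<beta>: "0 < \<beta>" "\<beta> < 1" and c: "c > 0" and s: "0 < s" "s < 1"
  shows "hausdorff_measure s (E_set \<beta> c) \<noteq> 0"
proof -
  obtain h where h0: "h 0 = 0" and h_step: "\<And>n. h (Suc n) = h n \<or> h (Suc n) = Suc (h n)"
    and lim: "(\<lambda>n. real (h n) / real n powr \<beta>) \<longlonglongrightarrow> c"
    using sublinear_counting_function[OF \<beta> c] by blast
  \<comment> \<open>The square root of the ideal factor \<open>2 powr (1 - s)\<close>: the other
    root is given up to the truncation at \<open>M\<close>.\<close>
  define \<theta> :: real where "\<theta> = 2 powr ((1 - s) / 2)"
  have \<theta>: "\<theta> > 1" using s by (simp add: \<theta>_def)
  obtain M :: nat where M: "M \<ge> 1" "1 - 2 / (real M + 2) > 1 / \<theta>"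
  proof -
    have "(\<lambda>M. 1 - 2 / (real M + 2)) \<longlonglongrightarrow> 1" by real_asymp
    then have "eventually (\<lambda>M. 1 - 2 / (real M + 2) > 1 / \<theta>) sequentially"
      using \<theta> by (intro order_tendstoD) auto
    from eventually_happens'[OF sequentially_bot eventually_conj[OF eventually_ge_at_top[of 1] this]]
    show ?thesis using that by blast
  qed
  have \<theta>M: "\<theta> \<le> 2 powr (1 - s) * (1 - 2 / (real M + 2))"
  proof -
    have "2 powr (1 - s) = \<theta> * \<theta>" by (simp add: \<theta>_def powr_add[symmetric])
    moreover have "\<theta> * \<theta> * (1 / \<theta>) \<le> \<theta> * \<theta> * (1 - 2 / (real M + 2))"
      using M(2) \<theta> by (intro mult_left_mono) auto
    ultimately show ?thesis using \<theta> by simp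
  qed
  \<comment> \<open>Prescribed digits lie above \<open>M\<close>, so they never coincide with the
    free ones.\<close>
  define D where "D n = (if h (Suc n) = h n then {1..M} else {M + h (Suc n)})" for n
  define B where "B n = real M + real n + 1" for n
  define z where "z n = (if h (Suc n) = h n then \<theta> else 1 / (3 * (B n)\<^sup>2))" for n
  interpret digit_tree D s
    by unfold_locales (use M s in \<open>auto simp: D_def\<close>)
  have B1: "B n \<ge> 1" for n by (simp add: B_def)
  have BD: "real k \<le> B n" if "k \<in> D n" for n k
    using that counting_le[of h "Suc n", OF h0 h_step] by (auto simp: D_def B_def split: if_splits)
  have z_pos: "z n > 0" for n using \<theta> B1[of n] by (auto simp: z_def)
  have z_le: "z (length v) * cyl_len v powr s \<le> (\<Sum>k\<in>D (length v). cyl_len (k # v) powr s)"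
    if v: "allowed v" for v
  proof (cases "h (Suc (length v)) = h (length v)")
    case True
    have "\<theta> * cyl_len v powr s \<le> 2 powr (1 - s) * (1 - 2 / (real M + 2)) * cyl_len v powr s"
      by (intro mult_right_mono \<theta>M) simp
    also have "\<dots> \<le> (\<Sum>k=1..M. cyl_len (k # v) powr s)"
      by (intro sum_cyl_len_powr_ge allowed_pos v s)
    finally show ?thesis using True by (simp add: z_def D_def)
  next
    case False
    define b k where "b = B (length v)" and "k = M + h (Suc (length v))"
    have kD: "D (length v) = {k}" using False by (simp add: D_def k_def)
    have b: "b \<ge> 1" by (simp add: b_def B1)
    have "1 \<le> b\<^sup>2" using b by (rule one_le_power)
    then have "1 \<le> 3 * b\<^sup>2" by linarith
    then have "1 / (3 * b\<^sup>2) \<le> (1 / (3 * b\<^sup>2)) powr s"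
      using s by (intro le_powr_of_le_1) (auto simp: divide_le_eq)
    then have "cyl_len v powr s * (1 / (3 * b\<^sup>2)) \<le> cyl_len v powr s * (1 / (3 * b\<^sup>2)) powr s"
      by (intro mult_left_mono) auto
    also have "\<dots> \<le> cyl_len (k # v) powr s"
      using M BD[of k "length v"] s kD
      by (intro cyl_len_Cons_powr_ge allowed_pos v) (auto simp: k_def b_def)
    finally show ?thesis using False kD by (simp add: z_def b_def mult.commute)
  qed
  have growth: "\<exists>\<kappa>>0. \<forall>n. \<kappa> * ((B n + 1)\<^sup>2 * (B (Suc n) + 1)) powr s \<le> (\<Prod>i<n. z i)"
  proof (rule ex_uniform_lower_bound)
    show "0 < (\<Prod>i<n. z i)" for n by (intro prod_pos) (simp add: z_pos)
    show "0 < ((B n + 1)\<^sup>2 * (B (Suc n) + 1)) powr s" for n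
      using B1[of n] B1[of "Suc n"] by simp
    \<comment> \<open>Each of the \<open>h m\<close> jumps replaces a factor \<open>\<theta>\<close>
      by \<open>1 / b\<close>. The loss at every jump is made equal by taking the largest bound,
      \<open>B n\<close>.\<close>
    have prod_eq: "(\<Prod>i<m. if h (Suc i) = h i then \<theta> else 1 / b) = \<theta> ^ m / (\<theta> * b) ^ h m"
      if "b > 0" for m and b :: real
    proof (induction m)
      case (Suc m)
      then show ?case using h_step[of m] that \<theta> by auto
    qed (simp add: h0)
    have "eventually (\<lambda>n. real (h n) / real n powr \<beta> < 2 * c) sequentially"
      using lim c by (intro order_tendstoD) auto
    \<comment> \<open>A polynomial to a power of order \<open>n powr \<beta>\<close> grows like the
      exponential of \<open>n powr \<beta>\<close> times a logarithm, which is slower than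
      \<open>\<theta> ^ n\<close> since \<open>\<beta> < 1\<close>.\<close>
    moreover have "eventually (\<lambda>n. (\<theta> * (3 * (real M + real n + 1)\<^sup>2)) powr (2 * c * real n powr \<beta>) *
        ((real M + real n + 2)\<^sup>2 * (real M + real n + 3)) \<le> \<theta> powr real n) sequentially"
      using \<beta> c \<theta> by real_asymp
    ultimately show "eventually (\<lambda>n. ((B n + 1)\<^sup>2 * (B (Suc n) + 1)) powr s \<le> (\<Prod>i<n. z i)) sequentially"
      using eventually_gt_at_top[of 0]
    proof eventually_elim
      case (elim n)
      define u where "u = \<theta> * (3 * (B n)\<^sup>2)"
      let ?G = "(B n + 1)\<^sup>2 * (B (Suc n) + 1)"
      have Bsq: "1 \<le> (B n)\<^sup>2" using B1[of n] by (rule one_le_power)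
      have u: "u \<ge> 1"
        unfolding u_def using mult_mono[of 1 \<theta> 1 "3 * (B n)\<^sup>2"] \<theta> Bsq by simp
      have "real (h n) \<le> 2 * c * real n powr \<beta>" using elim(1,3) by (simp add: divide_less_eq)
      then have uh: "u ^ h n \<le> u powr (2 * c * real n powr \<beta>)"
        using u by (subst powr_realpow[symmetric]) (auto intro: powr_mono)
      have G1: "?G \<ge> 1"
        using mult_mono[of 1 "(B n + 1)\<^sup>2" 1 "B (Suc n) + 1"] B1[of n] B1[of "Suc n"] by simp
      have "u ^ h n * ?G \<le> u powr (2 * c * real n powr \<beta>) * ?G"
        using uh G1 by (intro mult_right_mono) auto
      also have "\<dots> \<le> \<theta> powr real n"
        using elim(2) by (simp add: u_def B_def add.commute add.left_commute)
      also have "\<dots> = \<theta> ^ n" using \<theta> by (simp add: powr_realpow)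
      finally have "?G \<le> \<theta> ^ n / u ^ h n" using u by (simp add: field_simps)
      moreover have "?G powr s \<le> ?G" using G1 s by (intro powr_le_of_ge_1) auto
      moreover have "\<theta> ^ n / u ^ h n \<le> (\<Prod>i<n. z i)"
      proof -
        have "\<theta> ^ n / u ^ h n = (\<Prod>i<n. if h (Suc i) = h i then \<theta> else 1 / (3 * (B n)\<^sup>2))"
          unfolding u_def by (rule prod_eq[symmetric]) (use Bsq in linarith)
        also have "\<dots> \<le> (\<Prod>i<n. z i)"
        proof (intro prod_mono conjI)
          fix i assume i: "i \<in> {..<n}"
          show "0 \<le> (if h (Suc i) = h i then \<theta> else 1 / (3 * (B n)\<^sup>2))" using \<theta> by simp
          have "1 / (3 * (B n)\<^sup>2) \<le> 1 / (3 * (B i)\<^sup>2)"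
            using i B1[of i] B1[of n]
            by (intro divide_left_mono mult_left_mono power_mono mult_pos_pos zero_less_power) (auto simp: B_def)
          then show "(if h (Suc i) = h i then \<theta> else 1 / (3 * (B n)\<^sup>2)) \<le> z i" by (simp add: z_def)
        qed
        finally show ?thesis .
      qed
      ultimately show ?case by linarith
    qed
  qed
  then obtain \<kappa> where \<kappa>: "\<kappa> > 0" "\<And>n. \<kappa> * ((B n + 1)\<^sup>2 * (B (Suc n) + 1)) powr s \<le> (\<Prod>i<n. z i)"
    by blast
  show ?thesis
  proof (rule hausdorff_measure_nonzero[OF BD z_pos z_le \<kappa>])
    fix a x
    assume a: "\<And>n. a n \<in> D n" and x: "0 < x" "x < 1" "x \<notin> \<rat>" and d: "\<And>n. cf_digit x (Suc n) = a n"
    show "x \<in> E_set \<beta> c"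
    proof (rule E_set_memI[of h \<beta> c x "\<lambda>k. k - M" M])
      fix n assume "h (Suc n) \<noteq> h n"
      then show "cf_digit x (Suc n) - M = h (Suc n)" using a[of n] by (simp add: d D_def)
    next
      fix n assume "h (Suc n) = h n"
      then show "cf_digit x (Suc n) \<in> {1..M}" using a[of n] by (simp add: d D_def)
    qed (use h0 h_step lim x \<beta> in auto)
  qed
qed

lemma hausdorff_measure_F_set_nonzero:
  assumes c: "0 < c" "c \<le> 1" and s: "0 < s" "s < 1 / 2"
  shows "hausdorff_measure s (F_set c) \<noteq> 0"
proof -
  obtain h where h0: "h 0 = 0" and h_step: "\<And>n. h (Suc n) = h n \<or> h (Suc n) = Suc (h n)"
    and lim: "(\<lambda>n. real (h n) / real n powr 1) \<longlonglongrightarrow> c"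
    using linear_counting_function[OF c] by blast
  \<comment> \<open>Blocks of different jumps are disjoint, and the floor of the binary logarithm of
    a digit names its block.\<close>
  define D :: "nat \<Rightarrow> nat set"
    where "D n = (if h (Suc n) = h n then {1} else {2 ^ h (Suc n)..<2 ^ Suc (h (Suc n))})" for n
  define B :: "nat \<Rightarrow> real" where "B n = 2 ^ Suc (h (Suc n))" for n
  \<comment> \<open>A block of \<open>2 ^ j\<close> digits contributes that many terms of relative
    size at least \<open>2 powr (- 2 * j * s) / 12\<close>. The 12 comes from
    \<open>3 * b\<^sup>2\<close> with \<open>b = 2 ^ (j + 1)\<close>, and is also used for the digit
    1 to keep the product uniform.\<close>
  define z where "z n = (if h (Suc n) = h n then 1 else 2 powr ((1 - 2 * s) * real (h (Suc n)))) / 12" for n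
  interpret digit_tree D s
    by unfold_locales (use s in \<open>auto simp: D_def\<close>)
  have B1: "B n \<ge> 1" for n unfolding B_def by (rule one_le_power) simp
  have BD: "real k \<le> B n" if "k \<in> D n" for n k
  proof (cases "h (Suc n) = h n")
    case True
    then show ?thesis using that B1[of n] by (simp add: D_def)
  next
    case False
    then have "k \<le> 2 ^ Suc (h (Suc n))" using that by (simp add: D_def)
    then have "real k \<le> real (2 ^ Suc (h (Suc n)))" by (rule of_nat_mono)
    then show ?thesis by (simp add: B_def)
  qed
  have z_pos: "z n > 0" for n by (simp add: z_def)
  have z_le: "z (length v) * cyl_len v powr s \<le> (\<Sum>k\<in>D (length v). cyl_len (k # v) powr s)"
    if v: "allowed v" for v
  proof (cases "h (Suc (length v)) = h (length v)")
    case True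
    have "(1 / 12 :: real) \<le> 1 / 3" by simp
    also have "\<dots> \<le> (1 / 3) powr s" using s by (intro le_powr_of_le_1) auto
    finally have "cyl_len v powr s * (1 / 12) \<le> cyl_len v powr s * (1 / (3 * 1\<^sup>2)) powr s"
      by (intro mult_left_mono) auto
    also have "\<dots> \<le> cyl_len (1 # v) powr s"
      by (intro cyl_len_Cons_powr_ge allowed_pos v s) auto
    finally show ?thesis using True by (simp add: z_def D_def mult.commute)
  next
    case False
    define j where "j = h (Suc (length v))"
    define b where "b = B (length v)"
    have Dj: "D (length v) = {2 ^ j..<2 ^ Suc j}" using False by (simp add: D_def j_def)
    have b2: "3 * b\<^sup>2 = 12 * 2 powr (2 * real j)"
    proof -
      have "2 powr (2 * real j) = (2 ^ j)\<^sup>2"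
        by (simp add: powr_realpow[symmetric] powr_powr mult.commute flip: powr_numeral)
      then show ?thesis by (simp add: b_def B_def j_def power_mult_distrib)
    qed
    have "1 / 12 * 2 powr (- 2 * real j * s) \<le> (1 / 12) powr s * 2 powr (- 2 * real j * s)"
      using s by (intro mult_right_mono le_powr_of_le_1) auto
    also have "\<dots> = (1 / (3 * b\<^sup>2)) powr s"
      unfolding b2 by (simp add: powr_divide powr_mult powr_powr powr_minus_divide)
    finally have ge: "1 / 12 * 2 powr (- 2 * real j * s) \<le> (1 / (3 * b\<^sup>2)) powr s" .
    have "cyl_len v powr s * (1 / 12 * 2 powr (- 2 * real j * s)) \<le> cyl_len (k # v) powr s"
      if "k \<in> D (length v)" for k
    proof -
      have "cyl_len v powr s * (1 / 12 * 2 powr (- 2 * real j * s)) \<le> cyl_len v powr s * (1 / (3 * b\<^sup>2)) powr s"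
        by (intro mult_left_mono ge) simp
      also have "\<dots> \<le> cyl_len (k # v) powr s"
        using that BD[OF that] digit_ge_1[OF that] s
        by (intro cyl_len_Cons_powr_ge allowed_pos v) (auto simp: b_def)
      finally show ?thesis .
    qed
    then have "real (card (D (length v))) * (cyl_len v powr s * (1 / 12 * 2 powr (- 2 * real j * s)))
        \<le> (\<Sum>k\<in>D (length v). cyl_len (k # v) powr s)"
      by (rule sum_bounded_below)
    moreover have "real (card (D (length v))) = 2 powr real j"
      by (simp add: Dj powr_realpow)
    moreover have "2 powr real j * (cyl_len v powr s * (1 / 12 * 2 powr (- 2 * real j * s))) =
        2 powr ((1 - 2 * s) * real j) / 12 * cyl_len v powr s"
    proof -
      have "2 powr ((1 - 2 * s) * real j) = 2 powr real j * 2 powr (- 2 * real j * s)"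
        by (simp add: powr_add[symmetric] algebra_simps)
      then show ?thesis by (simp only: mult_ac times_divide_eq_left times_divide_eq_right mult_1 mult_1_right)
    qed
    ultimately have "2 powr ((1 - 2 * s) * real j) / 12 * cyl_len v powr s \<le>
        (\<Sum>k\<in>D (length v). cyl_len (k # v) powr s)"
      by (simp only:)
    then show ?thesis using False by (simp add: z_def j_def)
  qed
  have growth: "\<exists>\<kappa>>0. \<forall>n. \<kappa> * ((B n + 1)\<^sup>2 * (B (Suc n) + 1)) powr s \<le> (\<Prod>i<n. z i)"
  proof (rule ex_uniform_lower_bound)
    show "0 < (\<Prod>i<n. z i)" for n by (intro prod_pos) (simp add: z_pos)
    show "0 < ((B n + 1)\<^sup>2 * (B (Suc n) + 1)) powr s" for n
      using B1[of n] B1[of "Suc n"] by simp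
    \<comment> \<open>The jumps up to \<open>n\<close> run through the values 1 to
      \<open>h n\<close>, so the exponents add up to a triangular number.\<close>
    have prod_eq: "(\<Prod>i<n. z i) = 2 powr ((1 - 2 * s) * (real (h n) * (real (h n) + 1) / 2)) / 12 ^ n" for n
    proof (induction n)
      case (Suc n)
      show ?case
      proof (cases "h (Suc n) = h n")
        case True
        then show ?thesis using Suc by (simp add: z_def)
      next
        case False
        then have "h (Suc n) = Suc (h n)" using h_step[of n] by simp
        then have "(\<Prod>i<Suc n. z i) = 2 powr ((1 - 2 * s) * (real (h n) * (real (h n) + 1) / 2)) *
            2 powr ((1 - 2 * s) * (real (h n) + 1)) / 12 ^ Suc n"
          using Suc False by (simp add: z_def add.commute)
        also have "\<dots> = 2 powr ((1 - 2 * s) * (real (h (Suc n)) * (real (h (Suc n)) + 1) / 2)) / 12 ^ Suc n"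
          unfolding powr_add[symmetric] \<open>h (Suc n) = Suc (h n)\<close> by (simp add: field_simps)
        finally show ?thesis .
      qed
    qed (simp add: h0)
    have ev_h: "eventually (\<lambda>n. real (h n) / real n powr 1 > c / 2) sequentially"
      using lim c by (intro order_tendstoD) auto
    have h_ge: "eventually (\<lambda>n. c / 2 * real n \<le> real (h n)) sequentially"
      using ev_h eventually_gt_at_top[of 0]
      by eventually_elim (simp add: less_divide_eq less_imp_le)
    have "filterlim (\<lambda>n. c / 2 * real n) at_top sequentially" using c by real_asymp
    then have "filterlim (\<lambda>n. real (h n)) at_top sequentially"
      using h_ge by (rule filterlim_at_top_mono)
    \<comment> \<open>With \<open>y = h n\<close>, the term \<open>12 + 3 * y\<close> will bound the
      binary logarithm of the gap, and \<open>8 / c * y\<close> exceeds \<open>4 * n\<close>, which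
      pays for \<open>12 ^ n \<le> 16 ^ n\<close>. The right side wins because it is
      quadratic.\<close>
    moreover have "eventually (\<lambda>y::real. 12 + 3 * y + 8 / c * y \<le> (1 - 2 * s) * (y * (y + 1) / 2)) at_top"
    proof -
      have "1 - 2 * s > 0" using s by simp
      then show ?thesis by real_asymp
    qed
    ultimately have "eventually (\<lambda>n. 12 + 3 * real (h n) + 8 / c * real (h n) \<le>
        (1 - 2 * s) * (real (h n) * (real (h n) + 1) / 2)) sequentially"
      by (rule eventually_compose_filterlim[rotated])
    then show "eventually (\<lambda>n. ((B n + 1)\<^sup>2 * (B (Suc n) + 1)) powr s \<le> (\<Prod>i<n. z i)) sequentially"
      using h_ge
    proof eventually_elim
      case (elim n)
      let ?G = "(B n + 1)\<^sup>2 * (B (Suc n) + 1)"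
      have G1: "?G \<ge> 1"
        using mult_mono[of 1 "(B n + 1)\<^sup>2" 1 "B (Suc n) + 1"] B1[of n] B1[of "Suc n"] by simp
      \<comment> \<open>\<open>B (Suc n)\<close> involves \<open>h\<close> two steps after
        \<open>n\<close>, which raises the exponent by at most 2, besides the successor in
        \<open>B\<close>.\<close>
      have Bn: "B i \<le> 2 ^ (h n + 3)" if "i \<in> {n, Suc n}" for i
        unfolding B_def using that h_step[of n] h_step[of "Suc n"] by (intro power_increasing) auto
      have B4: "0 \<le> B i + 1" "B i + 1 \<le> 2 ^ (h n + 4)" if "i \<in> {n, Suc n}" for i
      proof -
        have "(1::real) \<le> 2 ^ (h n + 3)" by (rule one_le_power) simp
        then show "0 \<le> B i + 1" "B i + 1 \<le> 2 ^ (h n + 4)"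
          using Bn[OF that] B1[of i] by (auto simp: power_add)
      qed
      have "?G powr s \<le> ?G" using G1 s by (intro powr_le_of_ge_1) auto
      also have "?G \<le> (2 ^ (h n + 4))\<^sup>2 * 2 ^ (h n + 4)"
        using B4[of n] B4[of "Suc n"] by (intro mult_mono power_mono) auto
      also have "\<dots> = 2 powr (12 + 3 * real (h n))"
      proof -
        have "(2 ^ (h n + 4))\<^sup>2 * 2 ^ (h n + 4) = (2 :: real) ^ (12 + 3 * h n)"
          by (simp flip: power_mult power_add)
        also have "\<dots> = 2 powr real (12 + 3 * h n)" by (rule powr_realpow[symmetric]) simp
        finally show ?thesis by simp
      qed
      also have "\<dots> \<le> 2 powr ((1 - 2 * s) * (real (h n) * (real (h n) + 1) / 2) - 4 * real n)"
      proof -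
        have "4 * real n \<le> 8 / c * real (h n)" using elim(2) c by (simp add: field_simps)
        then show ?thesis using elim(1) by (intro powr_mono) linarith+
      qed
      also have "\<dots> = 2 powr ((1 - 2 * s) * (real (h n) * (real (h n) + 1) / 2)) / 16 ^ n"
        by (simp add: powr_diff powr_powr[symmetric] powr_realpow)
      also have "\<dots> \<le> (\<Prod>i<n. z i)"
        unfolding prod_eq by (intro divide_left_mono power_mono) auto
      finally show ?case .
    qed
  qed
  then obtain \<kappa> where \<kappa>: "\<kappa> > 0" "\<And>n. \<kappa> * ((B n + 1)\<^sup>2 * (B (Suc n) + 1)) powr s \<le> (\<Prod>i<n. z i)"
    by blast
  show ?thesis
  proof (rule hausdorff_measure_nonzero[OF BD z_pos z_le \<kappa>])
    fix a x
    assume a: "\<And>n. a n \<in> D n" and x: "0 < x" "x < 1" "x \<notin> \<rat>" and d: "\<And>n. cf_digit x (Suc n) = a n"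
    show "x \<in> F_set c"
      unfolding F_set_def
    proof (rule E_set_memI[of h 1 c x "\<lambda>k. nat \<lfloor>log 2 (real k)\<rfloor>" 1])
      fix n assume "h (Suc n) \<noteq> h n"
      then have "a n \<in> {2 ^ h (Suc n)..<2 ^ Suc (h (Suc n))}" using a[of n] by (simp add: D_def)
      then have "\<lfloor>log (real 2) (real (a n))\<rfloor> = int (h (Suc n))"
        by (intro floor_log_nat_eq_if) auto
      then show "nat \<lfloor>log 2 (real (cf_digit x (Suc n)))\<rfloor> = h (Suc n)" by (simp add: d)
    next
      fix n assume "h (Suc n) = h n"
      then show "cf_digit x (Suc n) \<in> {1..1}" using a[of n] by (simp add: d D_def)
    qed (use h0 h_step lim x in auto)
  qed
qed

text \<open>Convergence to \<open>c\<close> gives only an eventual lower bound by a smaller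
  constant; \<open>c / 2\<close> is the one used.\<close>

lemma hausdorff_measure_F_set_eq_0:
  assumes "c > 0" "s > 1 / 2"
  shows "hausdorff_measure s (F_set c) = 0"
proof (rule hausdorff_measure_many_digits_eq_0)
  show "s > 1 / 2" "c / 2 > 0" using assms by auto
  fix x assume "x \<in> F_set c"
  then have x: "0 \<le> x" "x < 1" "x \<notin> \<rat>" and lim: "(\<lambda>n. real (R_count n x) / real n powr 1) \<longlonglongrightarrow> c"
    by (auto simp: F_set_def E_set_def)
  have "x \<noteq> 0" using x(3) by (metis Rats_0)
  moreover have "eventually (\<lambda>n. real (R_count n x) / real n powr 1 > c / 2) sequentially"
    using lim assms by (intro order_tendstoD) auto
  then have "eventually (\<lambda>n. c / 2 * real n \<le> real (R_count n x)) sequentially"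
    using eventually_gt_at_top[of 0]
    by eventually_elim (simp add: less_divide_eq less_imp_le)
  ultimately show "0 < x \<and> x < 1 \<and> x \<notin> \<rat> \<and>
      eventually (\<lambda>n. c / 2 * real n \<le> real (R_count n x)) sequentially"
    using x by auto
qed

theorem theorem2:
  shows "(\<forall>\<beta> c. 0 < \<beta> \<and> \<beta> < 1 \<and> 0 < c \<longrightarrow> hausdorff_dim (E_set \<beta> c) = 1) \<and>
         (\<forall>c. 0 < c \<and> c \<le> 1 \<longrightarrow> hausdorff_dim (F_set c) = 1 / 2)"
proof (intro conjI allI impI; elim conjE)
  fix \<beta> c :: real assume "0 < \<beta>" "\<beta> < 1" "0 < c"
  then show "hausdorff_dim (E_set \<beta> c) = 1"
    by (intro hausdorff_dim_eqI hausdorff_measure_E_set_nonzero hausdorff_measure_unit_interval_eq_0)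
      (auto simp: E_set_def)
next
  fix c :: real assume "0 < c" "c \<le> 1"
  then show "hausdorff_dim (F_set c) = 1 / 2"
    by (intro hausdorff_dim_eqI hausdorff_measure_F_set_nonzero hausdorff_measure_F_set_eq_0) auto
qed

end
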